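(* For any ordered set $\mathcal{X}$ and $\mathcal{F}\subseteq\mathcal{X}^{\mathcal{X}}$, $$\frac{\operatorname{C}_T(\mathcal{F})}{2}\;\le\;\inf_{\mathcal{A}}\operatorname{FR}_{\mathcal{A}}(T,\mathcal{F})\;\le\;\operatorname{C}_T(\mathcal{F})+\sqrt{\operatorname{C}_T(\mathcal{F})\,T\,\ln\Big(\frac{T\,K_{\mathcal{F}}}{\operatorname{C}_T(\mathcal{F})}\Big)},$$ where $K_{\mathcal{F}}=\sup_{x\in\mathcal{X}}|\mathcal{F}(x)|$ and the infimum is over all (possibly randomized) learners. Moreover, both the lower and the upper bound can be tight.
   Context: $\mathcal{X}$ is a non-empty set (the state space), $\mathcal{F}\subseteq\mathcal{X}^{\mathcal{X}}$ is a class of functions, $T\in\mathbb{N}$ is the time horizon, and $[d]=\{1,\dots,d\}$. For $x\in\mathcal{X}$, $\mathcal{F}(x)=\{f(x):f\in\mathcal{F}\}$. $f^t$ is the $t$-fold composition of $f$ with itself. A learner $\mathcal{A}$ is a (possibly randomized) rule that maps every finite sequence of states $x_{<t} := (x_0,\dots,x_{t-1})$ to a prediction $\mathcal{A}(x_{<t}) \in \mathcal{X}$. Expected Flow regret: $$\operatorname{FR}_{\mathcal{A}}(T,\mathcal{F}) := \sup_{(x_0,x_1,\dots,x_T)}\Big(\mathbb{E}\Big[\sum_{t=1}^T\mathbf{1}\{\mathcal{A}(x_{<t})\ne x_t\}\Big]-\inf_{f\in\mathcal{F}}\sum_{t=1}^T\mathbf{1}\{f^t(x_0)\ne x_t\}\Big),$$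 with the supremum over sequences of states in $\mathcal{X}$ and the expectation over the learner's randomness. Trajectory tree of depth $d$: a sequence $\mathcal{T}=(\mathcal{T}_0,\mathcal{T}_1,\dots,\mathcal{T}_d)$ with $\mathcal{T}_0\in\mathcal{X}$ (the root label) and $\mathcal{T}_t:\{-1,1\}^t\to\mathcal{X}$ for $t\in[d]$. For $\sigma\in\{-1,1\}^d$, write $\sigma_{\le t}=(\sigma_1,\dots,\sigma_t)$ and $\sigma_{<t}=(\sigma_1,\dots,\sigma_{t-1})$. The tree $\mathcal{T}$ is shattered by $\mathcal{F}$ if for every $\sigma\in\{-1,1\}^d$ there is $f_\sigma\in\mathcal{F}$ with $f_\sigma(\mathcal{T}_{t-1}(\sigma_{<t}))=\mathcal{T}_t(\sigma_{\le t})$ for all $t\in[d]$. Branching factor: $\operatorname{B}(\mathcal{T}) := \min_{\sigma\in\{-1,1\}^d}\sum_{t=1}^d \mathbf{1}\{\mathcal{T}_t((\sigma_{<t},-1))\neq\mathcal{T}_t((\sigma_{<t},+1))\}$. Evolution complexity at depth $d$: $\operatorname{C}_d(\mathcal{F}) := \sup\{\operatorname{B}(\mathcal{T}) : \mathcal{T}\text{ is a trajectory tree of depth } d \text{ shattered by }\mathcal{F}\}$. *)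

theory Defs
  imports "HOL-Probability.Probability"
begin

text \<open>A randomized learner is a probability measure on deterministic prediction rules. Nothing is
  lost compared with an arbitrary probability space of internal randomness: a rule depending on
  such randomness pushes it forward to a measure of this kind. The state space carries no
  sigma-algebra, so all that is required is that "the prediction on the history \<open>xs\<close> is \<open>y\<close>"
  is an event. Deterministic learners are the point masses.\<close>

definition randomized_learners :: "('x list \<Rightarrow> 'x) measure set" where
  "randomized_learners =
     {M. prob_space M \<and> (\<forall>xs y. {A \<in> space M. A xs = y} \<in> sets M)}"

text \<open>The history \<open>(x\<^sub>0, \<dots>, x\<^sub>t\<^sub>-\<^sub>1)\<close> is \<open>map x [0..<t]\<close>; only the entries \<open>x 0, \<dots>, x T\<close> of the
  infinite sequence matter.\<close>

definition flow_regret :: "('x list \<Rightarrow> 'x) measure \<Rightarrow> nat \<Rightarrow> ('x \<Rightarrow> 'x) set \<Rightarrow> ereal" where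
  "flow_regret M T F =
     (SUP x :: nat \<Rightarrow> 'x. ereal
        ((LINT A|M. (\<Sum>t = 1..T. of_bool (A (map x [0..<t]) \<noteq> x t)))
         - (INF f\<in>F. (\<Sum>t = 1..T. of_bool ((f ^^ t) (x 0) \<noteq> x t) :: real))))"

definition minimax_flow_regret :: "nat \<Rightarrow> ('x \<Rightarrow> 'x) set \<Rightarrow> ereal" where
  "minimax_flow_regret T F = (INF M\<in>randomized_learners. flow_regret M T F)"

text \<open>A trajectory tree of depth \<open>d\<close> is given by a labelling of all sign sequences, \<open>False\<close> standing
  for \<open>-1\<close> and \<open>True\<close> for \<open>+1\<close>: the label \<open>T\<^sub>t(\<sigma>\<^sub>1, \<dots>, \<sigma>\<^sub>t)\<close> is \<open>tr [\<sigma>\<^sub>1, \<dots>, \<sigma>\<^sub>t]\<close> and the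
  root label is \<open>tr []\<close>. Labels of sequences longer than \<open>d\<close> are never used.\<close>

type_synonym 'x trajectory_tree = "bool list \<Rightarrow> 'x"

definition shattered :: "nat \<Rightarrow> ('x \<Rightarrow> 'x) set \<Rightarrow> 'x trajectory_tree \<Rightarrow> bool" where
  "shattered d F tr \<longleftrightarrow>
     (\<forall>\<sigma>. length \<sigma> = d \<longrightarrow>
        (\<exists>f\<in>F. \<forall>t\<in>{1..d}. f (tr (take (t - 1) \<sigma>)) = tr (take t \<sigma>)))"

definition branching_factor :: "nat \<Rightarrow> 'x trajectory_tree \<Rightarrow> nat" where
  "branching_factor d tr =
     (MIN \<sigma>\<in>{\<sigma>. length \<sigma> = d}.
        \<Sum>t = 1..d. of_bool (tr (take (t - 1) \<sigma> @ [False]) \<noteq> tr (take (t - 1) \<sigma> @ [True])))"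

text \<open>The branching factor of a tree of depth \<open>d\<close> is at most \<open>d\<close>, and for non-empty \<open>F\<close> some tree is
  shattered (follow a single function), so the supremum below is one of a non-empty bounded set
  of naturals.\<close>

definition evolution_complexity :: "nat \<Rightarrow> ('x \<Rightarrow> 'x) set \<Rightarrow> nat" where
  "evolution_complexity d F = Sup {branching_factor d tr | tr. shattered d F tr}"

definition ecard :: "'a set \<Rightarrow> enat" where
  "ecard A = (if finite A then enat (card A) else \<infinity>)"

definition max_images :: "('x \<Rightarrow> 'x) set \<Rightarrow> enat" where
  "max_images F = (SUP x. ecard ((\<lambda>f. f x) ` F))"

text \<open>The extended-real value of \<open>C + sqrt (C T ln (T K / C))\<close>. For \<open>C = 0\<close> the square root is
  read as \<open>0\<close> (also in the \<open>enat\<close> case, where \<open>C\<close> is a factor of its argument); for \<open>C > 0\<close> and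
  \<open>K = \<infinity>\<close> it is \<open>\<infinity>\<close>.\<close>

definition flow_regret_bound :: "nat \<Rightarrow> nat \<Rightarrow> enat \<Rightarrow> ereal" where
  "flow_regret_bound C T K =
     ereal (real C) +
     (case K of
        enat k \<Rightarrow> ereal (sqrt (real C * real T * ln (real T * real k / real C)))
      | \<infinity> \<Rightarrow> if C = 0 then 0 else \<infinity>)"

end

theory Submission
  imports Defs
begin

text \<open>Lower bound: along an optimal shattered tree the adversary can always move to a child which the
  learner predicts with probability at most \<open>1/2\<close>, while the functions of the tree make no mistake.

  Upper bound: a Sauer--Shelah argument bounds the number of trajectories of length \<open>T\<close> from a given
  state by \<open>\<Sum>i\<le>C. (T choose i) * (K - 1) ^ i\<close>, and exponential weights over these trajectories have
  regret \<open>sqrt (T ln N / 2)\<close> for \<open>N\<close> experts.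

  Tightness: for the lower bound take independent free bits at the first \<open>d\<close> steps, which a fair coin
  predicts as well as possible. For the upper bound take \<open>d\<close> blocks of length about \<open>T / d\<close>, the
  trajectory in each of them being governed by an arbitrary code of \<open>n \<approx> T / (2 d)\<close> bits. Then
  \<open>K = 2 ^ n\<close>, so the upper bound is of order \<open>T\<close>, and so is the regret.\<close>

subsection \<open>Learners and regret\<close>

text \<open>Recursion on the prefix \<open>h t\<close>, so each new entry can react to everything
  before it. This is how an adversary plays against the learner's predictions.\<close>

lemma history_choice:
  assumes "\<And>xs. \<exists>y. Q xs y"
  shows "\<exists>x :: nat \<Rightarrow> 'a. \<forall>t. Q (map x [0..<t]) (x t)"
proof -
  define h where "h = rec_nat [] (\<lambda>_ xs. xs @ [SOME y. Q xs y])"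
  define x where "x t = (SOME y. Q (h t) y)" for t
  have "map x [0..<t] = h t" for t
    by (induction t) (simp_all add: h_def x_def)
  moreover have "Q (h t) (x t)" for t
    unfolding x_def using assms by (rule someI_ex)
  ultimately show ?thesis by metis
qed

text \<open>By \<open>expected_mistakes\<close> the regret sees a learner only through these
  marginals.\<close>

definition predict_prob :: "('x list \<Rightarrow> 'x) measure \<Rightarrow> 'x list \<Rightarrow> 'x \<Rightarrow> real" where
  "predict_prob M xs y = measure M {A \<in> space M. A xs = y}"

lemma predict_prob_le_1:
  assumes "M \<in> randomized_learners"
  shows "predict_prob M xs y \<le> 1"
  using assms by (simp add: randomized_learners_def predict_prob_def prob_space.prob_le_1)

lemma sum_predict_prob_le_1:
  assumes M: "M \<in> randomized_learners" and "finite Y"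
  shows "(\<Sum>y\<in>Y. predict_prob M xs y) \<le> 1"
proof -
  interpret prob_space M using M by (simp add: randomized_learners_def)
  have "(\<Sum>y\<in>Y. predict_prob M xs y) = prob (\<Union>y\<in>Y. {A \<in> space M. A xs = y})"
    unfolding predict_prob_def using M \<open>finite Y\<close>
    by (intro finite_measure_finite_Union [symmetric])
      (auto simp: randomized_learners_def disjoint_family_on_def)
  then show ?thesis by (simp add: prob_le_1)
qed

text \<open>Distinct predictions share a total mass of at most 1, so they cannot all exceed the
  average. Both adversaries below pick their next state this way.\<close>

lemma exists_unlikely_prediction:
  assumes "M \<in> randomized_learners" "finite Y" "Y \<noteq> {}"
  shows "\<exists>y\<in>Y. predict_prob M xs y \<le> 1 / card Y"
proof (rule ccontr)
  assume "\<not> ?thesis"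
  then have "(\<Sum>y\<in>Y. 1 / card Y) < (\<Sum>y\<in>Y. predict_prob M xs y)"
    using assms by (intro sum_strict_mono) (auto simp: not_le)
  then show False using sum_predict_prob_le_1 [OF assms(1,2), of xs] assms by simp
qed

lemma expected_mistakes:
  assumes M: "M \<in> randomized_learners"
  shows "(LINT A|M. (\<Sum>t = 1..T. of_bool (A (map x [0..<t]) \<noteq> x t)) :: real)
    = (\<Sum>t = 1..T. 1 - predict_prob M (map x [0..<t]) (x t))"
proof -
  interpret prob_space M using M by (simp add: randomized_learners_def)
  have ev: "{A \<in> space M. A xs = y} \<in> events" for xs y
    using M by (simp add: randomized_learners_def)
  have ind: "(of_bool (A xs \<noteq> y) :: real) = 1 - indicator {A \<in> space M. A xs = y} A"
    if "A \<in> space M" for A xs y using that by (simp add: indicator_def)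
  have "(LINT A|M. (\<Sum>t = 1..T. of_bool (A (map x [0..<t]) \<noteq> x t)) :: real)
    = (LINT A|M. (\<Sum>t = 1..T. 1 - indicator {A \<in> space M. A (map x [0..<t]) = x t} A))"
    by (intro Bochner_Integration.integral_cong sum.cong refl ind)
  also have "\<dots> = (\<Sum>t = 1..T. 1 - predict_prob M (map x [0..<t]) (x t))"
    using ev by (simp add: predict_prob_def Bochner_Integration.integral_sum
        Bochner_Integration.integral_diff prob_space emeasure_eq_measure)
  finally show ?thesis .
qed

section \<open>Bounding the regret through single sequences and comparators\<close>

lemma bdd_below_mistakes:
  "bdd_below ((\<lambda>f. \<Sum>t = 1..T. of_bool ((f ^^ t) (x 0) \<noteq> x t) :: real) ` F)"
  by (rule bdd_belowI2 [where m = 0]) (simp add: sum_nonneg)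

lemma flow_regret_ge:
  assumes M: "M \<in> randomized_learners" and "f \<in> F"
  shows "ereal ((\<Sum>t = 1..T. 1 - predict_prob M (map x [0..<t]) (x t))
      - (\<Sum>t = 1..T. of_bool ((f ^^ t) (x 0) \<noteq> x t))) \<le> flow_regret M T F"
proof -
  have "(INF f\<in>F. (\<Sum>t = 1..T. of_bool ((f ^^ t) (x 0) \<noteq> x t) :: real))
      \<le> (\<Sum>t = 1..T. of_bool ((f ^^ t) (x 0) \<noteq> x t))"
    by (rule cINF_lower [OF bdd_below_mistakes \<open>f \<in> F\<close>])
  then show ?thesis
    unfolding flow_regret_def expected_mistakes [OF M]
    by (intro SUP_upper2 [where i = x]) auto
qed

lemma flow_regret_le:
  assumes M: "M \<in> randomized_learners" and "F \<noteq> {}"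
    and regret: "\<And>x f. f \<in> F \<Longrightarrow> (\<Sum>t = 1..T. 1 - predict_prob M (map x [0..<t]) (x t))
      \<le> (\<Sum>t = 1..T. of_bool ((f ^^ t) (x 0) \<noteq> x t)) + B"
  shows "flow_regret M T F \<le> ereal B"
  unfolding flow_regret_def expected_mistakes [OF M]
proof (intro SUP_least)
  fix x :: "nat \<Rightarrow> 'a"
  have "(\<Sum>t = 1..T. 1 - predict_prob M (map x [0..<t]) (x t)) - B
      \<le> (INF f\<in>F. (\<Sum>t = 1..T. of_bool ((f ^^ t) (x 0) \<noteq> x t) :: real))"
    using regret [where x = x] by (intro cINF_greatest \<open>F \<noteq> {}\<close>) (simp add: algebra_simps)
  then show "ereal ((\<Sum>t = 1..T. 1 - predict_prob M (map x [0..<t]) (x t))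
      - (INF f\<in>F. (\<Sum>t = 1..T. of_bool ((f ^^ t) (x 0) \<noteq> x t) :: real))) \<le> ereal B"
    by simp
qed

text \<open>Predictions on different histories can be drawn independently, because the expected number of
  mistakes depends only on the marginals.\<close>

lemma learner_from_pmfs:
  fixes q :: "'x list \<Rightarrow> 'x pmf"
  shows "\<exists>M\<in>randomized_learners. \<forall>xs y. predict_prob M xs y = pmf (q xs) y"
proof -
  define M where "M = PiM UNIV (\<lambda>xs. measure_pmf (q xs))"
  interpret product_prob_space "\<lambda>xs. measure_pmf (q xs)" UNIV
    by unfold_locales
  have vimage: "{A \<in> space M. A xs = y} = (\<lambda>A. A xs) -` {y} \<inter> space M" for xs y by auto
  have meas: "(\<lambda>A. A xs) \<in> measurable M (measure_pmf (q xs))" for xs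
    unfolding M_def by simp
  have "predict_prob M xs y = pmf (q xs) y" for xs y
  proof -
    have "predict_prob M xs y = measure (distr M (measure_pmf (q xs)) (\<lambda>A. A xs)) {y}"
      unfolding predict_prob_def vimage by (rule measure_distr [OF meas, symmetric]) simp
    also have "\<dots> = pmf (q xs) y"
      unfolding M_def by (simp add: PiM_component measure_pmf_single)
    finally show ?thesis .
  qed
  moreover have "M \<in> randomized_learners"
  proof -
    have "{A \<in> space M. A xs = y} \<in> sets M" for xs y
      unfolding vimage by (rule measurable_sets [OF meas]) simp
    moreover have "prob_space M" unfolding M_def by (rule prob_space_axioms)
    ultimately show ?thesis by (simp add: randomized_learners_def)
  qed
  ultimately show ?thesis by blast
qed

text \<open>Draw an expert with probability proportional to its weight and output its prediction
  \<open>g e\<close>; experts that agree pool their mass. The law \<open>p\<close> of the expert is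
  pushed forward along \<open>g\<close>.\<close>

lemma pmf_from_weights:
  fixes w :: "'e \<Rightarrow> real" and g :: "'e \<Rightarrow> 'x"
  assumes "finite S" "S \<noteq> {}" "\<And>e. w e > 0"
  shows "\<exists>q. \<forall>y. pmf q y = sum w {e \<in> S. g e = y} / sum w S"
proof -
  define W where "W = sum w S"
  have "W > 0" unfolding W_def using assms by (intro sum_pos) auto
  define p where "p = embed_pmf (\<lambda>e. if e \<in> S then w e / W else 0)"
  have "(\<integral>\<^sup>+ e. ennreal (if e \<in> S then w e / W else 0) \<partial>count_space UNIV)
      = (\<Sum>e\<in>S. ennreal (w e / W))"
    using assms(1) \<open>W > 0\<close> by (subst nn_integral_count_space'[of S]) auto
  also have "\<dots> = ennreal (\<Sum>e\<in>S. w e / W)"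
    using assms(3) \<open>W > 0\<close> by (intro sum_ennreal) (simp add: less_imp_le)
  also have "(\<Sum>e\<in>S. w e / W) = 1"
    using \<open>W > 0\<close> by (simp add: W_def flip: sum_divide_distrib)
  finally have p: "pmf p e = (if e \<in> S then w e / W else 0)" for e
    unfolding p_def using assms(3) \<open>W > 0\<close> by (subst pmf_embed_pmf) (auto simp: less_imp_le)
  have "pmf (map_pmf g p) y = sum w {e \<in> S. g e = y} / W" for y
  proof -
    have sub: "set_pmf p \<subseteq> S" by (auto simp: set_pmf_eq p)
    have "pmf (map_pmf g p) y = measure p (g -` {y})" by (simp add: pmf_map)
    also have "\<dots> = measure p {e \<in> S. g e = y}"
      using sub by (intro measure_eq_AE) (auto simp: AE_measure_pmf_iff)
    also have "\<dots> = (\<Sum>e\<in>{e \<in> S. g e = y}. w e / W)"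
      using assms(1) by (simp add: measure_measure_pmf_finite p)
    finally show ?thesis by (simp add: sum_divide_distrib)
  qed
  then show ?thesis unfolding W_def by blast
qed

subsection \<open>Shattered trees and the lower bound\<close>

lemma finite_bool_lists: "finite {\<sigma> :: bool list. length \<sigma> = d}"
  using finite_lists_length_eq [of "UNIV :: bool set" d] by simp

lemma le_branching_factor_iff:
  "k \<le> branching_factor d tr \<longleftrightarrow> (\<forall>\<sigma>. length \<sigma> = d \<longrightarrow>
     k \<le> (\<Sum>t = 1..d. of_bool (tr (take (t - 1) \<sigma> @ [False]) \<noteq> tr (take (t - 1) \<sigma> @ [True]))))"
  unfolding branching_factor_def
  by (subst Min_ge_iff) (auto simp: finite_bool_lists Ex_list_of_length)

lemma branching_factor_le:
  assumes "length \<sigma> = d"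
  shows "branching_factor d tr
    \<le> (\<Sum>t = 1..d. of_bool (tr (take (t - 1) \<sigma> @ [False]) \<noteq> tr (take (t - 1) \<sigma> @ [True])))"
  using le_branching_factor_iff [of "branching_factor d tr" d tr] assms by blast

lemma branching_factor_le_depth: "branching_factor d tr \<le> d"
proof -
  have "branching_factor d tr \<le> (\<Sum>t = 1..d. of_bool
      (tr (take (t - 1) (replicate d True) @ [False]) \<noteq> tr (take (t - 1) (replicate d True) @ [True])))"
    by (rule branching_factor_le) simp
  also have "\<dots> \<le> (\<Sum>t = 1..d. 1)" by (rule sum_mono) simp
  finally show ?thesis by simp
qed

lemma bdd_above_branching_factors: "bdd_above {branching_factor d tr | tr. shattered d F tr}"
  by (rule bdd_aboveI [where M = d]) (auto simp: branching_factor_le_depth)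

text \<open>Labels depend on the length only, so siblings agree and nothing branches. The tree
  witnesses that a non-empty class shatters something.\<close>

lemma shattered_path:
  assumes "f \<in> F"
  shows "shattered d F (\<lambda>\<sigma>. (f ^^ length \<sigma>) x)"
  unfolding shattered_def
proof (intro allI impI bexI ballI)
  fix \<sigma> :: "bool list" and t assume "length \<sigma> = d" "t \<in> {1..d}"
  then show "f ((f ^^ length (take (t - 1) \<sigma>)) x) = (f ^^ length (take t \<sigma>)) x"
    by (cases t) auto
qed (use assms in simp)

lemma branching_factor_le_evolution_complexity:
  assumes "shattered d F tr"
  shows "branching_factor d tr \<le> evolution_complexity d F"
  unfolding evolution_complexity_def
  by (rule cSup_upper) (use assms bdd_above_branching_factors in auto)

lemma evolution_complexity_attained:
  assumes "F \<noteq> {}"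
  obtains tr where "shattered d F tr" "branching_factor d tr = evolution_complexity d F"
proof -
  let ?S = "{branching_factor d tr | tr. shattered d F tr}"
  obtain f where "f \<in> F" using assms by blast
  from shattered_path [OF this, of d undefined] have "?S \<noteq> {}" by blast
  moreover have "finite ?S"
    by (rule finite_subset [of _ "{..d}"]) (auto simp: branching_factor_le_depth)
  ultimately have "evolution_complexity d F \<in> ?S"
    unfolding evolution_complexity_def using Max_in [of ?S] cSup_eq_Max [of ?S] by simp
  then obtain tr where "evolution_complexity d F = branching_factor d tr" "shattered d F tr"
    by blast
  then show thesis using that [of tr] by simp
qed

lemma evolution_complexity_le_depth:
  assumes "F \<noteq> {}"
  shows "evolution_complexity d F \<le> d"
  using evolution_complexity_attained [OF assms] branching_factor_le_depth by metis

text \<open>The one-step conditions chain from the root, so the witness of a leaf has the whole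
  branch as its orbit, and orbits are what the regret compares with.\<close>

lemma shattered_pathD:
  assumes "shattered d F tr" "length \<sigma> = d"
  obtains f where "f \<in> F" "\<And>t. t \<le> d \<Longrightarrow> (f ^^ t) (tr []) = tr (take t \<sigma>)"
proof -
  obtain f where f: "f \<in> F" "\<forall>t\<in>{1..d}. f (tr (take (t - 1) \<sigma>)) = tr (take t \<sigma>)"
    using assms unfolding shattered_def by blast
  have "(f ^^ t) (tr []) = tr (take t \<sigma>)" if "t \<le> d" for t
    using that
  proof (induction t)
    case (Suc t)
    then show ?case using f(2) [rule_format, of "Suc t"] by simp
  qed simp
  with f(1) show thesis using that by blast
qed

lemma half_evolution_complexity_le_flow_regret:
  assumes "F \<noteq> {}" and M: "M \<in> randomized_learners"
  shows "ereal (real (evolution_complexity T F) / 2) \<le> flow_regret M T F"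
proof -
  obtain tr where tr: "shattered T F tr" "branching_factor T tr = evolution_complexity T F"
    using evolution_complexity_attained [OF \<open>F \<noteq> {}\<close>] by blast
  define br where "br \<sigma> \<longleftrightarrow> tr (\<sigma> @ [False]) \<noteq> tr (\<sigma> @ [True])" for \<sigma>
  \<comment> \<open>The history at a node lists the labels of all its prefixes, itself included:
    hence \<open>Suc (length \<sigma>)\<close> entries.\<close>
  define p where "p \<sigma> b = predict_prob M (map (\<lambda>i. tr (take i \<sigma>)) [0..<Suc (length \<sigma>)]) (tr (\<sigma> @ [b]))"
    for \<sigma> b
  \<comment> \<open>At a branching node the children carry two distinct labels, one of which has
    probability at most 1/2. Elsewhere only the trivial bound 1 is claimed.\<close>
  have "\<exists>b. p \<sigma> b \<le> 1 - of_bool (br \<sigma>) / 2" for \<sigma>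
  proof (cases "br \<sigma>")
    case True
    then show ?thesis
      using exists_unlikely_prediction [OF M, of "{tr (\<sigma> @ [False]), tr (\<sigma> @ [True])}"
          "map (\<lambda>i. tr (take i \<sigma>)) [0..<Suc (length \<sigma>)]"]
      by (auto simp: br_def p_def simp del: upt_Suc)
  next
    case False
    then show ?thesis by (simp add: p_def predict_prob_le_1 [OF M])
  qed
  \<comment> \<open>The adversary's recursion runs over signs; the states are then the labels along
    the branch \<open>s\<close>.\<close>
  from history_choice [of "\<lambda>\<sigma> b. p \<sigma> b \<le> 1 - of_bool (br \<sigma>) / 2", OF this]
  obtain s where s: "p (map s [0..<t]) (s t) \<le> 1 - of_bool (br (map s [0..<t])) / 2" for t
    by blast
  define x where "x t = tr (map s [0..<t])" for t
  have err: "of_bool (br (map s [0..<t - 1])) / 2 \<le> 1 - predict_prob M (map x [0..<t]) (x t)"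
    if t: "t \<in> {1..T}" for t
  proof -
    obtain u where u: "t = Suc u" using t by (cases t) auto
    have "map (\<lambda>i. tr (take i (map s [0..<u]))) [0..<Suc u] = map x [0..<Suc u]"
      by (rule map_cong) (auto simp: x_def take_map)
    moreover have "tr (map s [0..<u] @ [s u]) = x (Suc u)" by (simp add: x_def)
    ultimately have "p (map s [0..<u]) (s u) = predict_prob M (map x [0..<t]) (x t)"
      unfolding p_def u length_map length_upt by (simp only: minus_nat.diff_0)
    with s [of u] show ?thesis by (simp add: u)
  qed
  obtain f where f: "f \<in> F" "\<And>t. t \<le> T \<Longrightarrow> (f ^^ t) (tr []) = tr (take t (map s [0..<T]))"
    using shattered_pathD [OF tr(1), of "map s [0..<T]"] by auto
  have no_mistake: "(f ^^ t) (x 0) = x t" if "t \<in> {1..T}" for t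
    using f(2) [of t] that by (simp add: x_def take_map)
  have "evolution_complexity T F \<le> (\<Sum>t = 1..T. of_bool (br (take (t - 1) (map s [0..<T]))))"
    unfolding br_def tr(2) [symmetric] by (rule branching_factor_le) simp
  also have "\<dots> = (\<Sum>t = 1..T. of_bool (br (map s [0..<t - 1])))"
    by (rule sum.cong) (auto simp: take_map)
  finally have "real (evolution_complexity T F)
      \<le> real (\<Sum>t = 1..T. of_bool (br (map s [0..<t - 1])))"
    by (rule of_nat_mono)
  then have "real (evolution_complexity T F) / 2 \<le> (\<Sum>t = 1..T. of_bool (br (map s [0..<t - 1])) / 2)"
    unfolding sum_divide_distrib [symmetric] of_nat_sum of_nat_of_bool by (rule divide_right_mono) simp
  also have "\<dots> \<le> (\<Sum>t = 1..T. 1 - predict_prob M (map x [0..<t]) (x t))"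
    by (rule sum_mono) (rule err)
  also have "\<dots> = (\<Sum>t = 1..T. 1 - predict_prob M (map x [0..<t]) (x t))
      - (\<Sum>t = 1..T. of_bool ((f ^^ t) (x 0) \<noteq> x t))"
    using no_mistake by simp
  finally show ?thesis
    using flow_regret_ge [OF M f(1), where T = T and x = x] by (meson ereal_less_eq(3) order_trans)
qed

corollary half_evolution_complexity_le_minimax_flow_regret:
  assumes "F \<noteq> {}"
  shows "ereal (real (evolution_complexity T F) / 2) \<le> minimax_flow_regret T F"
  unfolding minimax_flow_regret_def
  by (intro INF_greatest half_evolution_complexity_le_flow_regret assms)

subsection \<open>Counting trajectories\<close>

text \<open>The starting state is omitted as it is common to all, so entry \<open>t\<close> is the
  state after \<open>Suc t\<close> steps.\<close>

definition trajectories :: "('x \<Rightarrow> 'x) set \<Rightarrow> nat \<Rightarrow> 'x \<Rightarrow> 'x list set" where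
  "trajectories F n x = (\<lambda>f. map (\<lambda>t. (f ^^ Suc t) x) [0..<n]) ` F"

lemma trajectories_0: "trajectories F 0 x = (if F = {} then {} else {[]})"
  by (auto simp: trajectories_def)

text \<open>Sorting by the first step \<open>a\<close> leaves only the functions with
  \<open>f x = a\<close> for the continuation, because the same function must go on.\<close>

lemma trajectories_Suc:
  "trajectories F (Suc n) x
    = (\<Union>a\<in>(\<lambda>f. f x) ` F. (#) a ` trajectories {f \<in> F. f x = a} n a)"
proof -
  have step: "map (\<lambda>t. (f ^^ Suc t) x) [0..<Suc n] = f x # map (\<lambda>t. (f ^^ Suc t) (f x)) [0..<n]"
    for f :: "'a \<Rightarrow> 'a"
    by (simp add: upt_conv_Cons map_Suc_upt [symmetric] funpow_swap1 del: upt_Suc)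
  have fibre: "(#) a ` (\<lambda>f. map (\<lambda>t. (f ^^ Suc t) a) [0..<n]) ` {f \<in> F. f x = a}
      = (\<lambda>f. f x # map (\<lambda>t. (f ^^ Suc t) (f x)) [0..<n]) ` {f \<in> F. f x = a}" for a
    unfolding image_image by (rule image_cong) auto
  have "(\<Union>a\<in>(\<lambda>f. f x) ` F. {f \<in> F. f x = a}) = F" by blast
  then show ?thesis
    unfolding trajectories_def step fibre image_UN [symmetric] by simp
qed

text \<open>A local form of \<open>evolution_complexity\<close>: the root is fixed and the class may
  shrink, as the induction over the depth requires.\<close>

definition branches_from :: "nat \<Rightarrow> ('x \<Rightarrow> 'x) set \<Rightarrow> 'x \<Rightarrow> nat \<Rightarrow> bool" where
  "branches_from n F x k \<longleftrightarrow> (\<exists>tr. tr [] = x \<and> shattered n F tr \<and> k \<le> branching_factor n tr)"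

text \<open>In the counting this turns "no subtree at all after this step" into "no function takes
  this step".\<close>

lemma branches_from_0_iff: "branches_from n F x 0 \<longleftrightarrow> F \<noteq> {}"
proof
  assume "branches_from n F x 0"
  then obtain tr where tr: "shattered n F tr" by (auto simp: branches_from_def)
  show "F \<noteq> {}" using shattered_pathD [OF tr length_replicate] by blast
next
  assume "F \<noteq> {}"
  then obtain f where "f \<in> F" by blast
  then show "branches_from n F x 0"
    unfolding branches_from_def using shattered_path [of f F n x]
    by (intro exI [of _ "\<lambda>\<sigma>. (f ^^ length \<sigma>) x"]) simp
qed

lemma sum_1_Suc_shift:
  fixes g :: "nat \<Rightarrow> 'a :: comm_monoid_add"
  shows "(\<Sum>t = 1..Suc n. g t) = g 1 + (\<Sum>t = 1..n. g (Suc t))"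
  by (induction n) (simp_all add: add.assoc)

text \<open>The two trees are hung below a new root \<open>x\<close>. A witness of either tree sends
  \<open>x\<close> to the root of that tree, so it also serves the longer branch; every branch gains
  one branching exactly when \<open>a \<noteq> b\<close>.\<close>

lemma branches_from_graft:
  assumes "branches_from n {f \<in> F. f x = a} a k" "branches_from n {f \<in> F. f x = b} b k"
  shows "branches_from (Suc n) F x (k + of_bool (a \<noteq> b))"
proof -
  obtain l r where l: "l [] = a" "shattered n {f \<in> F. f x = a} l" "k \<le> branching_factor n l"
    and r: "r [] = b" "shattered n {f \<in> F. f x = b} r" "k \<le> branching_factor n r"
    using assms unfolding branches_from_def by blast
  define tr where "tr \<sigma> = (case \<sigma> of [] \<Rightarrow> x | c # \<sigma>' \<Rightarrow> if c then r \<sigma>' else l \<sigma>')" for \<sigma>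
  have tr_simps: "tr [] = x" "tr (c # \<sigma>) = (if c then r \<sigma> else l \<sigma>)" for c \<sigma>
    by (simp_all add: tr_def)
  have "shattered (Suc n) F tr"
    unfolding shattered_def
  proof (intro allI impI)
    fix \<sigma> :: "bool list" assume "length \<sigma> = Suc n"
    then obtain c \<sigma>' where \<sigma>: "\<sigma> = c # \<sigma>'" "length \<sigma>' = n" by (auto simp: length_Suc_conv)
    define s where "s = (if c then r else l)"
    have "shattered n {f \<in> F. f x = s []} s" using l r by (simp add: s_def)
    then obtain f where f: "f \<in> F" "f x = s []"
      "\<forall>t\<in>{1..n}. f (s (take (t - 1) \<sigma>')) = s (take t \<sigma>')"
      using \<sigma>(2) unfolding shattered_def by blast
    have "f (tr (take (t - 1) \<sigma>)) = tr (take t \<sigma>)" if t: "t \<in> {1..Suc n}" for t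
    proof (cases "t = 1")
      case True
      then show ?thesis using f(2) by (simp add: \<sigma> tr_simps s_def)
    next
      case False
      then obtain u where "t = Suc u" "u \<in> {1..n}" using t by (cases t) auto
      moreover from this have "f (s (take (u - 1) \<sigma>')) = s (take u \<sigma>')" using f(3) by blast
      ultimately show ?thesis by (cases u) (auto simp: \<sigma> tr_simps s_def split: if_splits)
    qed
    then show "\<exists>f\<in>F. \<forall>t\<in>{1..Suc n}. f (tr (take (t - 1) \<sigma>)) = tr (take t \<sigma>)"
      using f(1) by blast
  qed
  moreover have "k + of_bool (a \<noteq> b) \<le> branching_factor (Suc n) tr"
    unfolding le_branching_factor_iff
  proof (intro allI impI)
    fix \<sigma> :: "bool list" assume "length \<sigma> = Suc n"
    then obtain c \<sigma>' where \<sigma>: "\<sigma> = c # \<sigma>'" "length \<sigma>' = n" by (auto simp: length_Suc_conv)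
    define s where "s = (if c then r else l)"
    have "k \<le> (\<Sum>t = 1..n. of_bool (s (take (t - 1) \<sigma>' @ [False]) \<noteq> s (take (t - 1) \<sigma>' @ [True])))"
      using l r \<sigma>(2) by (auto simp: le_branching_factor_iff s_def)
    also have "\<dots> = (\<Sum>t = 1..n. of_bool (tr (take t \<sigma> @ [False]) \<noteq> tr (take t \<sigma> @ [True])))"
    proof (rule sum.cong)
      fix t assume "t \<in> {1..n}"
      then obtain u where "t = Suc u" by (cases t) auto
      then show "of_bool (s (take (t - 1) \<sigma>' @ [False]) \<noteq> s (take (t - 1) \<sigma>' @ [True]))
        = of_bool (tr (take t \<sigma> @ [False]) \<noteq> tr (take t \<sigma> @ [True]))"
        by (simp add: \<sigma> tr_simps s_def)
    qed simp
    finally show "k + of_bool (a \<noteq> b) \<le> (\<Sum>t = 1..Suc n.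
        of_bool (tr (take (t - 1) \<sigma> @ [False]) \<noteq> tr (take (t - 1) \<sigma> @ [True])))"
      using l(1) r(1) unfolding sum_1_Suc_shift by (simp add: tr_simps)
  qed
  ultimately show ?thesis unfolding branches_from_def using tr_simps(1) by blast
qed

text \<open>The size of a Hamming ball of radius \<open>d\<close> among the words of length
  \<open>n\<close> over \<open>k + 1\<close> letters.\<close>

definition sauer_bound :: "nat \<Rightarrow> nat \<Rightarrow> nat \<Rightarrow> nat" where
  "sauer_bound n d k = (\<Sum>i\<le>d. (n choose i) * k ^ i)"

lemma sauer_bound_ge_1: "1 \<le> sauer_bound n d k"
  unfolding sauer_bound_def by (simp add: sum.atMost_shift)

lemma sauer_bound_0: "sauer_bound n 0 k = 1"
  by (simp add: sauer_bound_def)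

lemma sauer_bound_Suc_Suc:
  "sauer_bound (Suc n) (Suc d) k = sauer_bound n (Suc d) k + k * sauer_bound n d k"
  unfolding sauer_bound_def sum.atMost_Suc_shift
  by (simp add: sum.distrib sum_distrib_left algebra_simps)

text \<open>At most one first step can be followed by a tree with the full branching factor, since grafting
  two such trees would produce a larger one. Counting the continuations of this step and of the
  at most \<open>k - 1\<close> others is Pascal's rule.\<close>

lemma card_trajectories_le:
  assumes "\<not> branches_from n F x (Suc d)"
    and "d > 0 \<Longrightarrow> \<forall>y. finite ((\<lambda>f. f y) ` F) \<and> card ((\<lambda>f. f y) ` F) \<le> k"
  shows "finite (trajectories F n x) \<and> card (trajectories F n x) \<le> sauer_bound n d (k - 1)"
  using assms
proof (induction n arbitrary: F x d)
  case 0
  show ?case using sauer_bound_ge_1 [of 0 d "k - 1"] by (simp add: trajectories_0)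
next
  case (Suc n)
  define A where "A = (\<lambda>f. f x) ` F"
  define G where "G a = {f \<in> F. f x = a}" for a
  define Y where "Y a = (#) a ` trajectories (G a) n a" for a
  have traj: "trajectories F (Suc n) x = (\<Union>a\<in>A. Y a)"
    unfolding trajectories_Suc A_def G_def Y_def ..
  have images: "finite ((\<lambda>f. f y) ` G a) \<and> card ((\<lambda>f. f y) ` G a) \<le> k" if "d > 0" for a y
  proof -
    have sub: "(\<lambda>f. f y) ` G a \<subseteq> (\<lambda>f. f y) ` F" by (auto simp: G_def)
    have "finite ((\<lambda>f. f y) ` F)" "card ((\<lambda>f. f y) ` F) \<le> k" using Suc.prems(2) that by auto
    with sub show ?thesis by (meson card_mono finite_subset order_trans)
  qed
  have card_Y: "finite (Y a) \<and> card (Y a) \<le> sauer_bound n e (k - 1)"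
    if "\<not> branches_from n (G a) a (Suc e)" "e \<le> d" for a e
  proof -
    have "finite (trajectories (G a) n a) \<and> card (trajectories (G a) n a) \<le> sauer_bound n e (k - 1)"
      by (rule Suc.IH) (use that images in auto)
    then show ?thesis unfolding Y_def using card_image_le le_trans by blast
  qed
  \<comment> \<open>Grafting a tree onto itself (\<open>a = b\<close>) prepends a step without
    branching, so the continuations inherit the bound \<open>d\<close>.\<close>
  have card_Y_full: "finite (Y a) \<and> card (Y a) \<le> sauer_bound n d (k - 1)" for a
    by (rule card_Y)
      (use Suc.prems(1) branches_from_graft [of n F x a "Suc d" a] in \<open>auto simp: G_def\<close>)
  obtain a\<^sub>0 where small: "\<And>a. a \<noteq> a\<^sub>0 \<Longrightarrow> \<not> branches_from n (G a) a d"
  proof (cases "\<exists>a. branches_from n (G a) a d")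
    case True
    then obtain a\<^sub>0 where "branches_from n (G a\<^sub>0) a\<^sub>0 d" by blast
    then have "\<not> branches_from n (G a) a d" if "a \<noteq> a\<^sub>0" for a
      using that Suc.prems(1) branches_from_graft [of n F x a d a\<^sub>0] by (auto simp: G_def)
    then show thesis using that by blast
  qed (use that in blast)
  show ?case
  proof (cases d)
    case 0
    \<comment> \<open>With no branching allowed, no function takes a step other than
      \<open>a\<^sub>0\<close>, and a single trajectory remains whatever the image sizes.\<close>
    then have "G a = {}" if "a \<noteq> a\<^sub>0" for a
      using small [OF that] by (simp add: branches_from_0_iff)
    then have "A \<subseteq> {a\<^sub>0}" unfolding A_def G_def by blast
    then have "trajectories F (Suc n) x \<subseteq> Y a\<^sub>0" unfolding traj by blast
    moreover have "finite (Y a\<^sub>0)" "card (Y a\<^sub>0) \<le> 1"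
      using card_Y_full [of a\<^sub>0] by (auto simp: 0 sauer_bound_0)
    ultimately show ?thesis
      unfolding 0 sauer_bound_0 by (meson card_mono finite_subset order_trans)
  next
    case d: (Suc e)
    have A: "finite A" "card A \<le> k" using Suc.prems(2) d by (auto simp: A_def)
    have card_Y_small: "card (Y a) \<le> sauer_bound n e (k - 1)" if "a \<noteq> a\<^sub>0" for a
      using card_Y [of a e] small [OF that] d by simp
    have "card (\<Union>a\<in>A. Y a) \<le> (\<Sum>a\<in>A. card (Y a))"
      by (rule card_UN_le [OF A(1)])
    also have "\<dots> \<le> sauer_bound n d (k - 1) + (k - 1) * sauer_bound n e (k - 1)"
    proof (cases "a\<^sub>0 \<in> A")
      case True
      have "(\<Sum>a\<in>A - {a\<^sub>0}. card (Y a)) \<le> (\<Sum>a\<in>A - {a\<^sub>0}. sauer_bound n e (k - 1))"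
        by (intro sum_mono card_Y_small) simp
      also have "\<dots> \<le> (k - 1) * sauer_bound n e (k - 1)"
        using A True by (simp add: card_Diff_singleton diff_le_mono)
      finally show ?thesis
        using card_Y_full [of a\<^sub>0] by (simp add: sum.remove [OF A(1) True])
    next
      case False
      \<comment> \<open>If \<open>a\<^sub>0\<close> is not among the first steps, any
        \<open>b\<close> in \<open>A\<close> takes its place as the one step counted with the larger
        bound.\<close>
      show ?thesis
      proof (cases "A = {}")
        case False
        then obtain b where b: "b \<in> A" by blast
        have "(\<Sum>a\<in>A - {b}. card (Y a)) \<le> (\<Sum>a\<in>A - {b}. sauer_bound n e (k - 1))"
          by (intro sum_mono card_Y_small) (use \<open>a\<^sub>0 \<notin> A\<close> in auto)
        also have "\<dots> \<le> (k - 1) * sauer_bound n e (k - 1)"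
          using A b by (simp add: card_Diff_singleton diff_le_mono)
        finally show ?thesis
          using card_Y_full [of b] by (simp add: sum.remove [OF A(1) b])
      qed simp
    qed
    finally show ?thesis
      using A(1) card_Y_full unfolding traj by (simp add: d sauer_bound_Suc_Suc)
  qed
qed

text \<open>Write \<open>n * k\<close> as \<open>d * r\<close> with \<open>r \<ge> 1\<close>: then
  \<open>r ^ i \<le> r ^ d\<close> comes out of the sum, and the rest is at most
  \<open>(1 + d / n) ^ n \<le> exp d\<close>.\<close>

lemma ln_sauer_bound_le:
  assumes "1 \<le> d" "d \<le> n" "1 \<le> k"
  shows "ln (sauer_bound n d k) \<le> d * (1 + ln (n * k / d))"
proof -
  define r where "r = real n * k / d"
  have "real d * 1 \<le> real n * real k" using assms by (intro mult_mono) auto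
  then have "1 \<le> r" using assms by (simp add: r_def field_simps)
  have "real (sauer_bound n d k) = (\<Sum>i\<le>d. (n choose i) * (d / n) ^ i * r ^ i)"
    unfolding sauer_bound_def of_nat_sum
    using assms by (intro sum.cong refl) (simp add: r_def power_mult_distrib power_divide)
  also have "\<dots> \<le> (\<Sum>i\<le>d. (n choose i) * (d / n) ^ i * r ^ d)"
    using \<open>1 \<le> r\<close> by (intro sum_mono mult_left_mono power_increasing) auto
  also have "\<dots> \<le> (\<Sum>i\<le>n. (n choose i) * (d / n) ^ i * r ^ d)"
    using assms \<open>1 \<le> r\<close> by (intro sum_mono2) auto
  also have "\<dots> = (d / n + 1) ^ n * r ^ d"
    by (simp add: binomial_ring sum_distrib_right)
  also have "\<dots> \<le> exp (d / n) ^ n * r ^ d"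
    using \<open>1 \<le> r\<close> by (intro mult_right_mono power_mono) (simp_all add: exp_ge_add_one_self add.commute)
  also have "\<dots> = exp d * r ^ d"
    using assms by (simp flip: exp_of_nat_mult)
  finally have "ln (real (sauer_bound n d k)) \<le> ln (exp d * r ^ d)"
    using sauer_bound_ge_1 [of n d k] by (subst ln_le_cancel_iff) (use \<open>1 \<le> r\<close> in auto)
  also have "\<dots> = d * (1 + ln r)"
    using \<open>1 \<le> r\<close> by (simp add: ln_mult ln_realpow algebra_simps)
  finally show ?thesis by (simp add: r_def)
qed

subsection \<open>Exponential weights and the upper bound\<close>

text \<open>Read \<open>r\<close> as the probability of a correct prediction: the left side is the
  mean of \<open>exp (- h)\<close> raised to the 0/1 loss. Hoeffding's lemma for the reward,
  multiplied by \<open>exp (- h)\<close>, gives the bound.\<close>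

lemma hoeffding_two_point:
  fixes h r :: real
  assumes "h \<ge> 0" "r \<ge> 0"
  shows "r + (1 - r) * exp (- h) \<le> exp (- h * (1 - r) + h\<^sup>2 / 8)"
proof -
  have pos: "1 + r * (exp h - 1) > 0" using assms by (simp add: add_pos_nonneg)
  have "ln (1 + r * (exp h - 1)) \<le> h * r + h\<^sup>2 / 8"
    using Hoeffdings_lemma_aux [OF assms] by simp
  then have "1 + r * (exp h - 1) \<le> exp (h * r + h\<^sup>2 / 8)"
    using pos by (metis exp_le_cancel_iff exp_ln)
  then have "exp (- h) * (1 + r * (exp h - 1)) \<le> exp (- h) * exp (h * r + h\<^sup>2 / 8)"
    by (rule mult_left_mono) simp
  also have "\<dots> = exp (- h * (1 - r) + h\<^sup>2 / 8)"
    by (simp add: algebra_simps flip: exp_add)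
  finally show ?thesis by (simp add: algebra_simps flip: exp_add)
qed

text \<open>The total weight \<open>W\<close> is a potential: each round shrinks it according to the
  learner's expected loss, while it never drops below the weight of the single expert
  \<open>e\<close>. Taking logarithms compares the two losses.\<close>

lemma hedge_learner:
  fixes E :: "'x \<Rightarrow> 'e set" and pred :: "'e \<Rightarrow> nat \<Rightarrow> 'x" and N \<eta> :: real
  assumes E: "\<And>a. finite (E a)" "\<And>a. E a \<noteq> {}" "\<And>a. card (E a) \<le> N" and "\<eta> > 0"
  shows "\<exists>M\<in>randomized_learners. \<forall>x T. \<forall>e\<in>E (x 0).
    (\<Sum>t = 1..T. 1 - predict_prob M (map x [0..<t]) (x t))
      \<le> (\<Sum>t = 1..T. of_bool (pred e t \<noteq> x t)) + (ln N / \<eta> + \<eta> * T / 8)"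
proof -
  define w where "w xs e = exp (- \<eta> * (\<Sum>s = 1..<length xs. of_bool (pred e s \<noteq> xs ! s)))" for xs e
  \<comment> \<open>The head of the history is the starting state, which selects the experts; its
    length is the round to be predicted. Only rounds \<open>t \<ge> 1\<close> are scored, so the
    empty history does not matter.\<close>
  have "\<exists>q. \<forall>y. pmf q y = sum (w xs) {e \<in> E (hd xs). pred e (length xs) = y} / sum (w xs) (E (hd xs))"
    for xs by (intro pmf_from_weights E) (simp add: w_def)
  then obtain q where q: "\<And>xs y. pmf (q xs) y
      = sum (w xs) {e \<in> E (hd xs). pred e (length xs) = y} / sum (w xs) (E (hd xs))"
    by metis
  obtain M where M: "M \<in> randomized_learners" "\<And>xs y. predict_prob M xs y = pmf (q xs) y"
    using learner_from_pmfs [of q] by blast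
  show ?thesis
  proof (intro bexI [OF _ M(1)] allI ballI)
    fix x :: "nat \<Rightarrow> 'x" and T e assume e: "e \<in> E (x 0)"
    define L where "L t e' = (\<Sum>s = 1..<t. of_bool (pred e' s \<noteq> x s) :: real)" for t e'
    define W where "W t = (\<Sum>e'\<in>E (x 0). exp (- \<eta> * L t e'))" for t
    define r where "r t = predict_prob M (map x [0..<t]) (x t)" for t
    have W_pos: "W t > 0" for t
      unfolding W_def using E by (intro sum_pos) auto
    have r: "r t = (\<Sum>e'\<in>{e' \<in> E (x 0). pred e' t = x t}. exp (- \<eta> * L t e')) / W t" if "t \<ge> 1" for t
    proof -
      have "w (map x [0..<t]) = (\<lambda>e'. exp (- \<eta> * L t e'))"
        by (auto simp: w_def L_def fun_eq_iff intro!: sum.cong)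
      moreover have "hd (map x [0..<t]) = x 0" using that by (simp add: hd_map)
      ultimately show ?thesis by (simp add: r_def M(2) q W_def)
    qed
    have r_nonneg: "r t \<ge> 0" for t by (simp add: r_def predict_prob_def)
    have step: "W (Suc t) \<le> W t * exp (- \<eta> * (1 - r t) + \<eta>\<^sup>2 / 8)" if "t \<ge> 1" for t
    proof -
      let ?C = "{e' \<in> E (x 0). pred e' t = x t}"
      \<comment> \<open>Every expert is discounted by \<open>exp (- \<eta>)\<close>, and the correct
        ones, which hold the fraction \<open>r t\<close> of the weight, get the difference
        back.\<close>
      have "W (Suc t) = (\<Sum>e'\<in>E (x 0). exp (- \<eta> * L t e') * exp (- \<eta> * of_bool (pred e' t \<noteq> x t)))"
        using that by (simp add: W_def L_def algebra_simps flip: exp_add)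
      also have "\<dots> = (\<Sum>e'\<in>E (x 0). exp (- \<eta>) * exp (- \<eta> * L t e')
          + (if pred e' t = x t then (1 - exp (- \<eta>)) * exp (- \<eta> * L t e') else 0))"
        by (intro sum.cong refl) (simp add: algebra_simps)
      also have "\<dots> = exp (- \<eta>) * W t + (1 - exp (- \<eta>)) * (\<Sum>e'\<in>?C. exp (- \<eta> * L t e'))"
        using E(1) [of "x 0"] by (simp add: sum.distrib W_def sum_distrib_left flip: sum.inter_filter)
      also have "(\<Sum>e'\<in>?C. exp (- \<eta> * L t e')) = r t * W t"
        using r [OF that] W_pos [of t] by simp
      also have "exp (- \<eta>) * W t + (1 - exp (- \<eta>)) * (r t * W t)
          = W t * (r t + (1 - r t) * exp (- \<eta>))"
        by (simp add: algebra_simps)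
      also have "\<dots> \<le> W t * exp (- \<eta> * (1 - r t) + \<eta>\<^sup>2 / 8)"
        using W_pos [of t] hoeffding_two_point [of \<eta> "r t"] r_nonneg \<open>\<eta> > 0\<close>
        by (intro mult_left_mono) auto
      finally show ?thesis .
    qed
    have "W (Suc T) \<le> N * exp (\<Sum>t = 1..T. - \<eta> * (1 - r t) + \<eta>\<^sup>2 / 8)"
    proof (induction T)
      case 0
      show ?case using E(3) [of "x 0"] by (simp add: W_def L_def)
    next
      case (Suc T)
      have "W (Suc (Suc T)) \<le> W (Suc T) * exp (- \<eta> * (1 - r (Suc T)) + \<eta>\<^sup>2 / 8)"
        by (rule step) simp
      also have "\<dots> \<le> N * exp (\<Sum>t = 1..T. - \<eta> * (1 - r t) + \<eta>\<^sup>2 / 8)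
          * exp (- \<eta> * (1 - r (Suc T)) + \<eta>\<^sup>2 / 8)"
        using Suc by (rule mult_right_mono) simp
      also have "\<dots> = N * exp (\<Sum>t = 1..Suc T. - \<eta> * (1 - r t) + \<eta>\<^sup>2 / 8)"
        by (simp add: mult.assoc flip: exp_add)
      finally show ?case .
    qed
    moreover have "exp (- \<eta> * L (Suc T) e) \<le> W (Suc T)"
      unfolding W_def using e E(1) by (intro member_le_sum) auto
    moreover have "(\<Sum>t = 1..T. - \<eta> * (1 - r t) + \<eta>\<^sup>2 / 8) = - \<eta> * (\<Sum>t = 1..T. 1 - r t) + T * \<eta>\<^sup>2 / 8"
      unfolding sum.distrib sum_distrib_left [symmetric] by simp
    ultimately have le: "exp (- \<eta> * L (Suc T) e)
        \<le> N * exp (- \<eta> * (\<Sum>t = 1..T. 1 - r t) + T * \<eta>\<^sup>2 / 8)"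
      by simp
    have "real (card (E (x 0))) > 0" using E by (simp add: card_gt_0_iff)
    then have "N > 0" using E(3) [of "x 0"] by simp
    have "- \<eta> * L (Suc T) e \<le> ln (N * exp (- \<eta> * (\<Sum>t = 1..T. 1 - r t) + T * \<eta>\<^sup>2 / 8))"
      using le \<open>N > 0\<close> by (subst ln_ge_iff) auto
    also have "\<dots> = ln N - \<eta> * (\<Sum>t = 1..T. 1 - r t) + T * \<eta>\<^sup>2 / 8"
      using \<open>N > 0\<close> by (simp add: ln_mult)
    finally have "\<eta> * (\<Sum>t = 1..T. 1 - r t) \<le> \<eta> * L (Suc T) e + ln N + T * \<eta>\<^sup>2 / 8"
      by simp
    also have "\<dots> = \<eta> * (L (Suc T) e + (ln N / \<eta> + \<eta> * T / 8))"
      using \<open>\<eta> > 0\<close> by (simp add: field_simps power2_eq_square)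
    finally have "(\<Sum>t = 1..T. 1 - r t) \<le> L (Suc T) e + (ln N / \<eta> + \<eta> * T / 8)"
      using \<open>\<eta> > 0\<close> by simp
    moreover have "L (Suc T) e = (\<Sum>t = 1..T. of_bool (pred e t \<noteq> x t))"
      unfolding L_def by (simp add: atLeastLessThanSuc_atLeastAtMost)
    ultimately show "(\<Sum>t = 1..T. 1 - predict_prob M (map x [0..<t]) (x t))
      \<le> (\<Sum>t = 1..T. of_bool (pred e t \<noteq> x t)) + (ln N / \<eta> + \<eta> * T / 8)"
      by (simp add: r_def)
  qed
qed

text \<open>The experts are the distinct trajectories from the starting state, not the functions, so
  even an infinite class yields finitely many of them.\<close>

lemma minimax_flow_regret_le_hedge:
  fixes N \<eta> :: real
  assumes "F \<noteq> {}" "\<And>a. finite (trajectories F T a)" "\<And>a. card (trajectories F T a) \<le> N" "\<eta> > 0"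
  shows "minimax_flow_regret T F \<le> ereal (ln N / \<eta> + \<eta> * T / 8)"
proof -
  have "trajectories F T a \<noteq> {}" for a using assms(1) by (simp add: trajectories_def)
  then obtain M where M: "M \<in> randomized_learners" and regret: "\<And>x T' e. e \<in> trajectories F T (x 0)
    \<Longrightarrow> (\<Sum>t = 1..T'. 1 - predict_prob M (map x [0..<t]) (x t))
      \<le> (\<Sum>t = 1..T'. of_bool (e ! (t - 1) \<noteq> x t)) + (ln N / \<eta> + \<eta> * T' / 8)"
    using hedge_learner [of "trajectories F T" N \<eta> "\<lambda>e t. e ! (t - 1)"] assms by blast
  have "flow_regret M T F \<le> ereal (ln N / \<eta> + \<eta> * T / 8)"
  proof (rule flow_regret_le [OF M \<open>F \<noteq> {}\<close>])
    fix x :: "nat \<Rightarrow> 'a" and f assume "f \<in> F"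
    define e where "e = map (\<lambda>t. (f ^^ Suc t) (x 0)) [0..<T]"
    have "e \<in> trajectories F T (x 0)" using \<open>f \<in> F\<close> by (auto simp: trajectories_def e_def)
    then have "(\<Sum>t = 1..T. 1 - predict_prob M (map x [0..<t]) (x t))
      \<le> (\<Sum>t = 1..T. of_bool (e ! (t - 1) \<noteq> x t)) + (ln N / \<eta> + \<eta> * T / 8)"
      by (rule regret)
    also have "(\<Sum>t = 1..T. of_bool (e ! (t - 1) \<noteq> x t)) = (\<Sum>t = 1..T. of_bool ((f ^^ t) (x 0) \<noteq> x t) :: real)"
    proof (rule sum.cong)
      fix t assume "t \<in> {1..T}"
      then obtain u where "t = Suc u" "u < T" by (cases t) auto
      then show "of_bool (e ! (t - 1) \<noteq> x t) = (of_bool ((f ^^ t) (x 0) \<noteq> x t) :: real)"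
        by (simp add: e_def)
    qed simp
    finally show "(\<Sum>t = 1..T. 1 - predict_prob M (map x [0..<t]) (x t))
      \<le> (\<Sum>t = 1..T. of_bool ((f ^^ t) (x 0) \<noteq> x t)) + (ln N / \<eta> + \<eta> * T / 8)" .
  qed
  then show ?thesis unfolding minimax_flow_regret_def by (rule INF_lower2 [OF M])
qed

lemma minimax_flow_regret_le_flow_regret_bound:
  assumes "F \<noteq> {}"
  shows "minimax_flow_regret T F \<le> flow_regret_bound (evolution_complexity T F) T (max_images F)"
proof -
  define C where "C = evolution_complexity T F"
  have "C \<le> T" unfolding C_def by (rule evolution_complexity_le_depth [OF assms])
  have unbranched: "\<not> branches_from T F x (Suc C)" for x
    using branching_factor_le_evolution_complexity [of T F] by (fastforce simp: branches_from_def C_def)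
  show ?thesis
  proof (cases "C = 0")
    case True
    have traj: "finite (trajectories F T x)" "card (trajectories F T x) \<le> 1" for x
      using card_trajectories_le [of T F x 0] unbranched by (auto simp: True sauer_bound_0)
    \<comment> \<open>A single expert has \<open>ln 1 = 0\<close>, so the regret vanishes as the
      learning rate tends to 0.\<close>
    have "minimax_flow_regret T F \<le> ereal (\<epsilon> * T / 8)" if "\<epsilon> > 0" for \<epsilon> :: real
      using minimax_flow_regret_le_hedge [of F T 1 \<epsilon>] assms traj that by simp
    note le = this
    have "minimax_flow_regret T F \<le> 0"
    proof (rule ereal_le_epsilon2)
      fix e :: real assume "e > 0"
      \<comment> \<open>The denominator \<open>T + 1\<close> also covers
        \<open>T = 0\<close>.\<close>
      have "minimax_flow_regret T F \<le> ereal (8 * e / (T + 1) * T / 8)"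
        by (rule le) (use \<open>e > 0\<close> in simp)
      also have "\<dots> \<le> 0 + ereal e" using \<open>e > 0\<close> by (simp add: field_simps)
      finally show "minimax_flow_regret T F \<le> 0 + ereal e" .
    qed
    moreover have "flow_regret_bound C T (max_images F) = 0"
      by (simp add: True flow_regret_bound_def zero_ereal_def split: enat.split)
    ultimately show ?thesis by (simp add: C_def)
  next
    case False
    show ?thesis
    proof (cases "max_images F")
      case (enat k)
      have images: "finite ((\<lambda>f. f y) ` F) \<and> card ((\<lambda>f. f y) ` F) \<le> k" for y
      proof -
        have "ecard ((\<lambda>f. f y) ` F) \<le> enat k"
          unfolding enat [symmetric] max_images_def by (rule SUP_upper) simp
        then show ?thesis by (simp add: ecard_def split: if_splits)
      qed
      define L where "L = ln (real T * k / C)"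
      have traj: "finite (trajectories F T x)" "card (trajectories F T x) \<le> sauer_bound T C (k - 1)" for x
        using card_trajectories_le [of T F x C k] unbranched images by auto
      have "C \<ge> 1" using False by simp
      have "T \<ge> 1" using \<open>C \<ge> 1\<close> \<open>C \<le> T\<close> by simp
      have "k \<ge> 1"
        using images [of undefined] assms by (metis card_gt_0_iff image_is_empty less_one not_le order_less_le_trans)
      have "real T * k \<ge> real T * 1" using \<open>k \<ge> 1\<close> by (intro mult_left_mono) auto
      then have "ln (T / C) \<le> L"
        unfolding L_def using \<open>C \<ge> 1\<close> \<open>T \<ge> 1\<close> by (subst ln_le_cancel_iff) (auto intro: divide_right_mono)
      \<comment> \<open>The inequality \<open>L \<ge> 1 - C / T\<close> is what later absorbs the
        extra 1 in \<open>1 + L\<close>.\<close>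
      moreover have "1 - C / T \<le> ln (T / C)"
        using ln_le_minus_one [of "C / T"] \<open>C \<ge> 1\<close> \<open>T \<ge> 1\<close> by (simp add: ln_div)
      ultimately have L: "1 - C / T \<le> L" by simp
      moreover have "C / T \<le> 1" using \<open>C \<le> T\<close> \<open>T \<ge> 1\<close> by simp
      ultimately have "L \<ge> 0" by linarith
      define a where "a = C * (1 + L)"
      have "a > 0" using \<open>C \<ge> 1\<close> \<open>L \<ge> 0\<close> by (simp add: a_def add_pos_nonneg)
      \<comment> \<open>This rate balances \<open>a / \<eta>\<close> and
        \<open>\<eta> * T / 8\<close>; their sum is \<open>sqrt (a * T / 2)\<close>.\<close>
      define \<eta> where "\<eta> = sqrt (8 * a / T)"
      have "\<eta> > 0" using \<open>a > 0\<close> \<open>T \<ge> 1\<close> by (simp add: \<eta>_def)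
      \<comment> \<open>The logarithmic estimate asks for a positive last argument, and
        \<open>k - 1\<close> may be 0.\<close>
      have "sauer_bound T C (k - 1) \<le> sauer_bound T C k"
        unfolding sauer_bound_def by (intro sum_mono mult_left_mono power_mono) auto
      then have "ln (real (sauer_bound T C (k - 1))) \<le> ln (real (sauer_bound T C k))"
        using sauer_bound_ge_1 [of T C "k - 1"] by (intro ln_mono) auto
      also have "\<dots> \<le> a"
        unfolding a_def L_def using ln_sauer_bound_le [OF \<open>C \<ge> 1\<close> \<open>C \<le> T\<close> \<open>k \<ge> 1\<close>] .
      finally have "ln (real (sauer_bound T C (k - 1))) / \<eta> + \<eta> * T / 8 \<le> a / \<eta> + \<eta> * T / 8"
        using \<open>\<eta> > 0\<close> by (simp add: divide_right_mono)
      also have "a / \<eta> = \<eta> * T / 8"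
      proof -
        have "\<eta> * \<eta> = 8 * a / T" using \<open>a > 0\<close> by (simp add: \<eta>_def)
        then show ?thesis using \<open>\<eta> > 0\<close> \<open>T \<ge> 1\<close> by (simp add: field_simps)
      qed
      also have "\<eta> * T / 8 + \<eta> * T / 8 \<le> C + sqrt (C * T * L)"
      proof (rule power2_le_imp_le)
        have "(\<eta> * T / 8 + \<eta> * T / 8)\<^sup>2 = a * T / 2"
          using \<open>a > 0\<close> \<open>T \<ge> 1\<close> by (simp add: \<eta>_def power2_eq_square field_simps)
        also have "\<dots> = C * T * L + C * (T * (1 - L)) / 2"
          by (simp add: a_def field_simps)
        also have "\<dots> \<le> C * T * L + real C * C"
        proof -
          have "T * (1 - L) \<le> real T * (C / T)" using L by (intro mult_left_mono) auto
          then have "C * (T * (1 - L)) \<le> C * real C"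
            using \<open>T \<ge> 1\<close> by (intro mult_left_mono) auto
          moreover have "0 \<le> real C * C" by simp
          ultimately show ?thesis by linarith
        qed
        also have "\<dots> \<le> (C + sqrt (C * T * L))\<^sup>2"
          using \<open>L \<ge> 0\<close> by (simp add: power2_sum flip: power2_eq_square)
        finally show "(\<eta> * T / 8 + \<eta> * T / 8)\<^sup>2 \<le> (C + sqrt (C * T * L))\<^sup>2" .
      qed (use \<open>L \<ge> 0\<close> in simp)
      finally have "ereal (ln (sauer_bound T C (k - 1)) / \<eta> + \<eta> * T / 8)
          \<le> flow_regret_bound C T (max_images F)"
        by (simp add: enat flow_regret_bound_def L_def)
      moreover have "minimax_flow_regret T F
          \<le> ereal (ln (sauer_bound T C (k - 1)) / \<eta> + \<eta> * T / 8)"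
        by (rule minimax_flow_regret_le_hedge) (use assms traj \<open>\<eta> > 0\<close> in auto)
      ultimately show ?thesis unfolding C_def by (rule order_trans [rotated])
    qed (use False in \<open>simp add: flow_regret_bound_def C_def\<close>)
  qed
qed

subsection \<open>A class attaining the lower bound\<close>

text \<open>When the first \<open>t\<close> states depend only on the bits before \<open>t\<close>,
  the orbits of \<open>g b\<close> fit together into a shattered tree; \<open>D\<close> collects
  levels at which every node branches.\<close>

lemma card_le_evolution_complexity:
  fixes g :: "(nat \<Rightarrow> bool) \<Rightarrow> 'x \<Rightarrow> 'x"
  assumes g: "\<And>b. g b \<in> F"
    and dep: "\<And>b b' t. (\<And>i. i < t \<Longrightarrow> b i = b' i) \<Longrightarrow> (g b ^^ t) x = (g b' ^^ t) x"
    and D: "D \<subseteq> {..<T}"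
    and diff: "\<And>b t. t \<in> D \<Longrightarrow> (g (b(t := False)) ^^ Suc t) x \<noteq> (g (b(t := True)) ^^ Suc t) x"
  shows "card D \<le> evolution_complexity T F"
proof -
  \<comment> \<open>A finite sign sequence is padded with \<open>False\<close> to an infinite
    one.\<close>
  define b where "b \<sigma> i \<longleftrightarrow> i < length \<sigma> \<and> \<sigma> ! i" for \<sigma> i
  define tr where "tr \<sigma> = (g (b \<sigma>) ^^ length \<sigma>) x" for \<sigma>
  have tr_take: "tr (take t \<sigma>) = (g (b \<sigma>) ^^ t) x" if "t \<le> length \<sigma>" for t \<sigma>
    using that dep [of t "b (take t \<sigma>)" "b \<sigma>"] by (simp add: tr_def b_def)
  have tr_child: "tr (take t \<sigma> @ [c]) = (g ((b \<sigma>)(t := c)) ^^ Suc t) x" if "t < length \<sigma>" for t \<sigma> c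
  proof -
    have "(g (b (take t \<sigma> @ [c])) ^^ Suc t) x = (g ((b \<sigma>)(t := c)) ^^ Suc t) x"
      using that by (intro dep) (auto simp: b_def nth_append less_Suc_eq)
    then show ?thesis using that by (simp add: tr_def)
  qed
  have "shattered T F tr"
    unfolding shattered_def
  proof (intro allI impI bexI ballI)
    fix \<sigma> :: "bool list" and t assume "length \<sigma> = T" "t \<in> {1..T}"
    then obtain u where "t = Suc u" "Suc u \<le> length \<sigma>" by (cases t) auto
    then show "g (b \<sigma>) (tr (take (t - 1) \<sigma>)) = tr (take t \<sigma>)"
      by (simp add: tr_take)
  qed (rule g)
  moreover have "card D \<le> branching_factor T tr"
    unfolding le_branching_factor_iff
  proof (intro allI impI)
    fix \<sigma> :: "bool list" assume \<sigma>: "length \<sigma> = T"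
    have "card D = (\<Sum>t\<in>Suc ` D. of_bool
        (tr (take (t - 1) \<sigma> @ [False]) \<noteq> tr (take (t - 1) \<sigma> @ [True])))"
    proof -
      have "tr (take t \<sigma> @ [False]) \<noteq> tr (take t \<sigma> @ [True])" if "t \<in> D" for t
        using that D \<sigma> diff [OF that, of "b \<sigma>"] by (subst (1 2) tr_child) auto
      then show ?thesis by (simp add: sum.reindex del: of_bool_eq_iff)
    qed
    also have "\<dots> \<le> (\<Sum>t = 1..T. of_bool
        (tr (take (t - 1) \<sigma> @ [False]) \<noteq> tr (take (t - 1) \<sigma> @ [True])))"
      using D by (intro sum_mono2) auto
    finally show "card D \<le> \<dots>" .
  qed
  ultimately show ?thesis
    using branching_factor_le_evolution_complexity by (meson order_trans)
qed

section \<open>Estimates for the upper bound from a bound on the image sizes\<close>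

lemma max_images_le:
  assumes "\<And>y. (\<lambda>f. f y) ` F \<subseteq> S y" "\<And>y. finite (S y)" "\<And>y. card (S y) \<le> k"
  shows "max_images F \<le> enat k"
  unfolding max_images_def
proof (rule SUP_least)
  fix y
  have "finite ((\<lambda>f. f y) ` F)" "card ((\<lambda>f. f y) ` F) \<le> k"
    using assms by (meson card_mono finite_subset order_trans)+
  then show "ecard ((\<lambda>f. f y) ` F) \<le> enat k" by (simp add: ecard_def)
qed

lemma flow_regret_bound_le:
  assumes "1 \<le> d" "d \<le> T" "1 \<le> k" "K \<le> enat k"
  shows "flow_regret_bound d T K \<le> ereal (d + sqrt (d * T * ln (T * k / d)))"
proof -
  obtain k' where k': "K = enat k'" "k' \<le> k" using assms(4) by (cases K) auto
  have "real d * 1 \<le> real T * real k" using assms by (intro mult_mono) auto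
  then have "1 \<le> real T * k / d" using assms by simp
  \<comment> \<open>For \<open>k' = 0\<close> the left side is \<open>ln 0 = 0\<close>, which is
    fine since the other argument is at least 1.\<close>
  then have "ln (real T * k' / d) \<le> ln (real T * k / d)"
    using k' assms by (cases "k' = 0") (auto intro!: ln_mono divide_right_mono mult_left_mono)
  then show ?thesis
    by (simp add: flow_regret_bound_def k'(1) mult_left_mono)
qed

text \<open>A state \<open>n\<close> holds the time \<open>n div 2\<close> and, in its parity, the
  bit last shown. The next bit depends on the time alone and is 0 from time \<open>d\<close>
  on.\<close>

definition coin_map :: "nat \<Rightarrow> (nat \<Rightarrow> bool) \<Rightarrow> nat \<Rightarrow> nat" where
  "coin_map d b n = 2 * Suc (n div 2) + of_bool (n div 2 < d \<and> b (n div 2))"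

definition coin_class :: "nat \<Rightarrow> (nat \<Rightarrow> nat) set" where
  "coin_class d = range (coin_map d)"

lemma coin_map_funpow_div2: "(coin_map d b ^^ t) x div 2 = x div 2 + t"
  by (induction t) (simp_all add: coin_map_def)

lemma coin_map_funpow_Suc:
  "(coin_map d b ^^ Suc t) x = 2 * Suc (x div 2 + t) + of_bool (x div 2 + t < d \<and> b (x div 2 + t))"
  by (simp add: coin_map_def coin_map_funpow_div2)

text \<open>The learner guesses a fair coin where a bit is free. A mistake of the comparator pays
  for one of the learner; otherwise the excess is at most 1/2, at no more than \<open>d\<close>
  times.\<close>

lemma minimax_flow_regret_coin_class_le:
  "minimax_flow_regret T (coin_class d) \<le> ereal (d / 2)"
proof -
  \<comment> \<open>The time is computed from the starting state and the length of the history,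
    since the later states need not follow any function.\<close>
  define q where "q xs = (let a = hd xs div 2 + (length xs - 1) in
    if a < d then pmf_of_set {2 * Suc a, Suc (2 * Suc a)} else return_pmf (2 * Suc a))" for xs
  obtain M where M: "M \<in> randomized_learners" "\<And>xs y. predict_prob M xs y = pmf (q xs) y"
    using learner_from_pmfs [of q] by blast
  have "flow_regret M T (coin_class d) \<le> ereal (d / 2)"
  proof (rule flow_regret_le [OF M(1)])
    show "coin_class d \<noteq> {}" by (simp add: coin_class_def)
    fix x :: "nat \<Rightarrow> nat" and f assume "f \<in> coin_class d"
    then obtain b where f: "f = coin_map d b" by (auto simp: coin_class_def)
    have "1 - predict_prob M (map x [0..<t]) (x t)
        \<le> of_bool ((f ^^ t) (x 0) \<noteq> x t) + of_bool (x 0 div 2 + t \<le> d) / 2" if t: "t \<in> {1..T}" for t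
    proof -
      obtain u where u: "t = Suc u" using t by (cases t) auto
      have q: "q (map x [0..<t]) = (if x 0 div 2 + u < d
          then pmf_of_set {2 * Suc (x 0 div 2 + u), Suc (2 * Suc (x 0 div 2 + u))}
          else return_pmf (2 * Suc (x 0 div 2 + u)))"
        by (simp add: q_def u hd_map Let_def del: upt_Suc)
      show ?thesis
      proof (cases "(f ^^ t) (x 0) = x t")
        case True
        then have "x t = 2 * Suc (x 0 div 2 + u) + of_bool (x 0 div 2 + u < d \<and> b (x 0 div 2 + u))"
          unfolding f u coin_map_funpow_Suc by simp
        then have "1 - of_bool (x 0 div 2 + u < d) / 2 \<le> pmf (q (map x [0..<t])) (x t)"
          unfolding q by (auto simp: pmf_of_set indicator_def)
        then show ?thesis by (auto simp: M(2) u Suc_le_eq)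
      next
        case False
        then have "of_bool ((f ^^ t) (x 0) \<noteq> x t) = (1 :: real)" by simp
        moreover have "0 \<le> of_bool (x 0 div 2 + t \<le> d) / (2 :: real)" by simp
        ultimately show ?thesis
          using pmf_nonneg [of "q (map x [0..<t])" "x t"] unfolding M(2) by linarith
      qed
    qed
    then have "(\<Sum>t = 1..T. 1 - predict_prob M (map x [0..<t]) (x t))
        \<le> (\<Sum>t = 1..T. of_bool ((f ^^ t) (x 0) \<noteq> x t) + of_bool (x 0 div 2 + t \<le> d) / 2)"
      by (rule sum_mono)
    also have "\<dots> = (\<Sum>t = 1..T. of_bool ((f ^^ t) (x 0) \<noteq> x t))
        + card ({1..T} \<inter> {t. x 0 div 2 + t \<le> d}) / 2"
      by (simp add: sum.distrib flip: sum_divide_distrib)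
    also have "card ({1..T} \<inter> {t. x 0 div 2 + t \<le> d}) \<le> card {1..d}"
      by (rule card_mono) auto
    finally show "(\<Sum>t = 1..T. 1 - predict_prob M (map x [0..<t]) (x t))
        \<le> (\<Sum>t = 1..T. of_bool ((f ^^ t) (x 0) \<noteq> x t)) + d / 2"
      by simp
  qed
  then show ?thesis unfolding minimax_flow_regret_def by (rule INF_lower2 [OF M(1)])
qed

text \<open>The upper estimate comes from the regret: half the complexity is at most the minimax
  regret, which is at most \<open>d / 2\<close>.\<close>

lemma evolution_complexity_coin_class:
  assumes "d \<le> T"
  shows "evolution_complexity T (coin_class d) = d"
proof (rule antisym)
  have "coin_class d \<noteq> {}" by (simp add: coin_class_def)
  from half_evolution_complexity_le_minimax_flow_regret [OF this, of T]
  have "ereal (real (evolution_complexity T (coin_class d)) / 2) \<le> ereal (d / 2)"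
    using minimax_flow_regret_coin_class_le by (rule order_trans)
  then show "evolution_complexity T (coin_class d) \<le> d" by simp
next
  have "card {..<d} \<le> evolution_complexity T (coin_class d)"
  proof (rule card_le_evolution_complexity [where x = 0])
    fix b b' :: "nat \<Rightarrow> bool" and t assume "\<And>i. i < t \<Longrightarrow> b i = b' i"
    then show "(coin_map d b ^^ t) 0 = (coin_map d b' ^^ t) 0"
      by (cases t) (simp_all only: coin_map_funpow_Suc, simp_all)
  next
    fix b :: "nat \<Rightarrow> bool" and t assume "t \<in> {..<d}"
    then show "(coin_map d (b(t := False)) ^^ Suc t) 0 \<noteq> (coin_map d (b(t := True)) ^^ Suc t) 0"
      unfolding coin_map_funpow_Suc by simp
  qed (use assms in \<open>auto simp: coin_class_def\<close>)
  then show "d \<le> evolution_complexity T (coin_class d)" by simp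
qed

lemma minimax_flow_regret_coin_class:
  assumes "d \<le> T"
  shows "minimax_flow_regret T (coin_class d) = ereal (d / 2)"
proof (rule antisym)
  have "coin_class d \<noteq> {}" by (simp add: coin_class_def)
  from half_evolution_complexity_le_minimax_flow_regret [OF this, of T]
  show "ereal (d / 2) \<le> minimax_flow_regret T (coin_class d)"
    by (simp add: evolution_complexity_coin_class [OF assms])
qed (rule minimax_flow_regret_coin_class_le)

lemma max_images_coin_class: "max_images (coin_class d) \<le> enat 2"
  by (rule max_images_le [where S = "\<lambda>y. {2 * Suc (y div 2), Suc (2 * Suc (y div 2))}"])
    (auto simp: coin_class_def coin_map_def)

subsection \<open>A class attaining the upper bound up to a constant\<close>

text \<open>Codes are written into the state only every other step, where a single branching reveals the
  whole code of the block; in between, the state is one of two values. So many functions share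
  each state that carries a bit, although no path branches twice within a block.\<close>

definition block_map :: "nat \<Rightarrow> (nat \<Rightarrow> nat) \<Rightarrow> nat \<Rightarrow> nat" where
  "block_map n w s = (case prod_decode s of (t, v) \<Rightarrow>
     prod_encode (Suc t, if even t then w (t div 2 div n) else of_bool (bit v (t div 2 mod n))))"

text \<open>A block takes \<open>2 * n\<close> steps. Bounded codes keep the images within
  \<open>2 ^ n\<close> states, and zero codes from block \<open>d\<close> on leave only
  \<open>d\<close> blocks free.\<close>

definition block_class :: "nat \<Rightarrow> nat \<Rightarrow> (nat \<Rightarrow> nat) set" where
  "block_class n d = block_map n ` {w. (\<forall>j. w j < 2 ^ n) \<and> (\<forall>j\<ge>d. w j = 0)}"

lemma block_map_encode:
  "block_map n w (prod_encode (t, v))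
    = prod_encode (Suc t, if even t then w (t div 2 div n) else of_bool (bit v (t div 2 mod n)))"
  by (simp add: block_map_def)

section \<open>Image size and complexity of the block class\<close>

lemma block_class_nonempty: "block_class n d \<noteq> {}"
  by (auto simp: block_class_def intro!: exI [of _ "\<lambda>_. 0"])

lemma fst_decode_block_map: "fst (prod_decode (block_map n w s)) = Suc (fst (prod_decode s))"
  by (simp add: block_map_def split: prod.split)

lemma max_images_block_class:
  assumes "1 \<le> n"
  shows "max_images (block_class n d) \<le> enat (2 ^ n)"
proof (rule max_images_le)
  fix s
  let ?S = "(\<lambda>v. prod_encode (Suc (fst (prod_decode s)), v)) ` {..<2 ^ n}"
  have "(1 :: nat) < 2 ^ n" using one_less_power [of "2 :: nat" n] assms by simp
  then have "of_bool b < (2 ^ n :: nat)" for b by (cases b) auto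
  then show "(\<lambda>f. f s) ` block_class n d \<subseteq> ?S"
    by (auto simp: block_class_def block_map_def split: prod.split)
  show "finite ?S" by simp
  show "card ?S \<le> 2 ^ n" using card_image_le [of "{..<2 ^ n :: nat}"] by simp
qed

text \<open>Along the all-\<open>True\<close> branch of an optimal tree, a branching in a block
  fixes the code of that block for all functions that stay on the branch. So the block index
  \<open>j\<close> is injective on the branching levels \<open>B\<close>, with values below
  \<open>d\<close>.\<close>

lemma evolution_complexity_block_class_le:
  "evolution_complexity T (block_class n d) \<le> d"
proof -
  obtain tr where tr: "shattered T (block_class n d) tr"
    "branching_factor T tr = evolution_complexity T (block_class n d)"
    using evolution_complexity_attained [OF block_class_nonempty] by blast
  define \<sigma> where "\<sigma> = replicate T True"
  define y where "y u = tr (take u \<sigma>)" for u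
  define l where "l u = fst (prod_decode (tr [])) + u" for u
  define B where "B = {u. u < T \<and> tr (take u \<sigma> @ [False]) \<noteq> tr (take u \<sigma> @ [True])}"
  \<comment> \<open>Each child of a node on the branch lies on some full branch
    \<open>\<tau>\<close>, whose witness runs along \<open>y\<close> up to that node.\<close>
  have consistent: "\<exists>w. (\<forall>j\<ge>d. w j = 0) \<and> (\<forall>v\<le>u. (block_map n w ^^ v) (tr []) = y v)
      \<and> block_map n w (y u) = tr (take u \<sigma> @ [c])" if "u < T" for u c
  proof -
    define \<tau> where "\<tau> = take u \<sigma> @ [c] @ replicate (T - Suc u) True"
    have "length \<tau> = T" using that by (simp add: \<tau>_def \<sigma>_def)
    then obtain f where f: "f \<in> block_class n d" "\<And>t. t \<le> T \<Longrightarrow> (f ^^ t) (tr []) = tr (take t \<tau>)"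
      using shattered_pathD [OF tr(1)] by blast
    then obtain w where w: "f = block_map n w" "\<forall>j\<ge>d. w j = 0"
      by (auto simp: block_class_def)
    have y: "(f ^^ v) (tr []) = y v" if "v \<le> u" for v
      using f(2) [of v] that \<open>u < T\<close> by (simp add: y_def \<tau>_def \<sigma>_def min_def)
    moreover have "f (y u) = tr (take u \<sigma> @ [c])"
      using f(2) [of "Suc u"] y [of u] \<open>u < T\<close> by (simp add: \<tau>_def \<sigma>_def)
    ultimately show ?thesis using w by blast
  qed
  have layer: "fst (prod_decode ((block_map n w ^^ u) (tr []))) = l u" for w u
    by (induction u) (simp_all add: l_def fst_decode_block_map)
  have decode: "\<exists>v. y u = prod_encode (l u, v)" if u: "u < T" for u
  proof -
    obtain w where "(block_map n w ^^ u) (tr []) = y u" using consistent [OF u, of True] by blast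
    then have "fst (prod_decode (y u)) = l u" using layer by metis
    then show ?thesis by (metis prod.collapse prod_decode_inverse)
  qed
  define j where "j u = l u div 2 div n" for u
  have branch: "\<exists>w w'. (\<forall>v\<le>u. (block_map n w ^^ v) (tr []) = y v)
      \<and> (\<forall>v\<le>u. (block_map n w' ^^ v) (tr []) = y v) \<and> even (l u) \<and> w (j u) \<noteq> w' (j u) \<and> j u < d"
    if "u \<in> B" for u
  proof -
    have "u < T" using that by (simp add: B_def)
    obtain v where v: "y u = prod_encode (l u, v)" using decode [OF \<open>u < T\<close>] by blast
    obtain w where w: "\<forall>j\<ge>d. w j = 0" "\<forall>v\<le>u. (block_map n w ^^ v) (tr []) = y v"
      "block_map n w (y u) = tr (take u \<sigma> @ [False])"
      using consistent [OF \<open>u < T\<close>] by blast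
    obtain w' where w': "\<forall>j\<ge>d. w' j = 0" "\<forall>v\<le>u. (block_map n w' ^^ v) (tr []) = y v"
      "block_map n w' (y u) = tr (take u \<sigma> @ [True])"
      using consistent [OF \<open>u < T\<close>] by blast
    have "block_map n w (y u) \<noteq> block_map n w' (y u)"
      using that w(3) w'(3) by (simp add: B_def)
    \<comment> \<open>In odd layers the next state does not depend on the code, so a branching
      forces an even layer and different codes.\<close>
    then have *: "even (l u)" "w (j u) \<noteq> w' (j u)"
      by (auto simp: v block_map_encode j_def split: if_splits)
    then have "j u < d" using w(1) w'(1) by (metis not_le)
    with * w w' show ?thesis by blast
  qed
  have "j u \<noteq> j u'" if u: "u \<in> B" and u': "u' \<in> B" and "u < u'" for u u'
  proof
    assume "j u = j u'"
    have "u < T" using u by (simp add: B_def)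
    obtain v where v: "y u = prod_encode (l u, v)" using decode [OF \<open>u < T\<close>] by blast
    obtain w w' where w: "\<forall>v\<le>u'. (block_map n w ^^ v) (tr []) = y v"
      "\<forall>v\<le>u'. (block_map n w' ^^ v) (tr []) = y v" "w (j u') \<noteq> w' (j u')"
      using branch [OF u'] by blast
    have "even (l u)" using branch [OF u] by blast
    have "block_map n w (y u) = y (Suc u)" "block_map n w' (y u) = y (Suc u)"
      using w(1,2) [rule_format, of u] w(1,2) [rule_format, of "Suc u"] \<open>u < u'\<close> by auto
    \<comment> \<open>Both functions leave \<open>y u\<close> for the same state; as its layer is
      even, that state contains the code.\<close>
    then have "block_map n w (y u) = block_map n w' (y u)" by simp
    then have "w (j u) = w' (j u)" using \<open>even (l u)\<close> by (simp add: v block_map_encode j_def)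
    with w(3) \<open>j u = j u'\<close> show False by simp
  qed
  then have "inj_on j B" by (intro inj_onI) (metis nat_neq_iff)
  moreover have "j ` B \<subseteq> {..<d}" using branch by blast
  ultimately have "card B \<le> d" using card_inj_on_le [of j B "{..<d}"] by simp
  have "evolution_complexity T (block_class n d)
      \<le> (\<Sum>t = 1..T. of_bool (tr (take (t - 1) \<sigma> @ [False]) \<noteq> tr (take (t - 1) \<sigma> @ [True])))"
    unfolding tr(2) [symmetric] by (rule branching_factor_le) (simp add: \<sigma>_def)
  also have "\<dots> = (\<Sum>u<T. of_bool (tr (take u \<sigma> @ [False]) \<noteq> tr (take u \<sigma> @ [True])))"
    by (simp only: One_nat_def sum.atLeast1_atMost_eq diff_Suc_Suc minus_nat.diff_0)
  also have "\<dots> = card B"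
    by (simp add: B_def lessThan_def Collect_conj_eq [symmetric])
  finally show ?thesis using \<open>card B \<le> d\<close> by simp
qed

lemma block_map_funpow_layer:
  "fst (prod_decode ((block_map n w ^^ t) (prod_encode (0, 0)))) = t"
  by (induction t) (simp_all add: fst_decode_block_map)

lemma block_map_funpow_Suc:
  obtains v where "(block_map n w ^^ t) (prod_encode (0, 0)) = prod_encode (t, v)"
    "(block_map n w ^^ Suc t) (prod_encode (0, 0)) = prod_encode (Suc t,
      if even t then w (t div 2 div n) else of_bool (bit v (t div 2 mod n)))"
proof -
  obtain v where "(block_map n w ^^ t) (prod_encode (0, 0)) = prod_encode (t, v)"
    using block_map_funpow_layer [where n = n and w = w and t = t] by (metis prod.collapse prod_decode_inverse)
  then show thesis using that [of v] by (simp add: block_map_encode)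
qed

text \<open>Codes 0 and 1 alone provide one free sign per block, read at the first step
  \<open>2 * n * j\<close> of the block.\<close>

lemma evolution_complexity_block_class_ge:
  assumes "1 \<le> n" "2 * n * d \<le> T"
  shows "d \<le> evolution_complexity T (block_class n d)"
proof -
  define w where "w b j = (if j < d then of_bool (b (2 * n * j)) else 0 :: nat)" for b j
  define D where "D = (\<lambda>j. 2 * n * j) ` {..<d}"
  have "card D \<le> evolution_complexity T (block_class n d)"
  proof (rule card_le_evolution_complexity [where g = "\<lambda>b. block_map n (w b)"])
    fix b :: "nat \<Rightarrow> bool"
    have "w b j < 2 ^ n" for j
      using one_less_power [of "2 :: nat" n] assms(1) by (auto simp: w_def)
    then show "block_map n (w b) \<in> block_class n d"
      by (auto simp: block_class_def w_def)
  next
    fix b b' :: "nat \<Rightarrow> bool" and t assume "\<And>i. i < t \<Longrightarrow> b i = b' i"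
    then show "(block_map n (w b) ^^ t) (prod_encode (0, 0)) = (block_map n (w b') ^^ t) (prod_encode (0, 0))"
    proof (induction t)
      case (Suc t)
      have IH: "(block_map n (w b) ^^ t) (prod_encode (0, 0)) = (block_map n (w b') ^^ t) (prod_encode (0, 0))"
        using Suc by simp
      \<comment> \<open>The current block began no later than time \<open>t\<close>, so its sign is
        among those on which \<open>b\<close> and \<open>b'\<close> agree.\<close>
      have "2 * n * (t div 2 div n) \<le> t"
        by (metis div_mult2_eq mult.commute div_times_less_eq_dividend)
      then have "w b (t div 2 div n) = w b' (t div 2 div n)"
        using Suc.prems by (simp add: w_def)
      moreover obtain v where "(block_map n (w b) ^^ t) (prod_encode (0, 0)) = prod_encode (t, v)"
        by (rule block_map_funpow_Suc)
      ultimately show ?case using IH by (simp add: block_map_encode)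
    qed simp
  next
    show "D \<subseteq> {..<T}"
    proof
      fix t assume "t \<in> D"
      then obtain j where j: "t = 2 * n * j" "j < d" by (auto simp: D_def)
      then have "2 * n * j < 2 * n * d" using assms(1) by simp
      then show "t \<in> {..<T}" unfolding j(1) using assms(2) by (simp only: lessThan_iff less_le_trans)
    qed
  next
    fix b :: "nat \<Rightarrow> bool" and t assume "t \<in> D"
    then obtain j where j: "t = 2 * n * j" "j < d" by (auto simp: D_def)
    have "(block_map n (w (b(t := c))) ^^ Suc t) (prod_encode (0, 0)) = prod_encode (Suc t, of_bool c)" for c
      using assms(1) j by (rule_tac block_map_funpow_Suc [where n = n and w = "w (b(t := c))" and t = t])
        (simp add: w_def)
    then show "(block_map n (w (b(t := False))) ^^ Suc t) (prod_encode (0, 0))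
        \<noteq> (block_map n (w (b(t := True))) ^^ Suc t) (prod_encode (0, 0))"
      by simp
  qed
  moreover have "card D = d"
    unfolding D_def using assms(1) by (subst card_image) (auto simp: inj_on_def)
  ultimately show ?thesis by simp
qed

text \<open>This allows the comparator's codes to be read off the adversary's sequence
  afterwards.\<close>

lemma exists_nat_with_bits: "\<exists>v :: nat. v < 2 ^ n \<and> (\<forall>i<n. bit v i \<longleftrightarrow> p i)"
proof (intro exI conjI allI impI)
  let ?v = "horner_sum of_bool 2 (map p [0..<n]) :: nat"
  show "?v < 2 ^ n" using horner_sum_of_bool_2_less [of "map p [0..<n]"]
    by simp
  show "bit ?v i \<longleftrightarrow> p i" if "i < n" for i using that by (simp add: bit_horner_sum_bit_iff)
qed

text \<open>In the bit steps the learner errs with probability at least one half while some code makes no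
  mistake; in the remaining steps eight possible states make up for a mistake of the comparator
  except for one eighth.\<close>

lemma minimax_flow_regret_block_class_ge:
  assumes "1 \<le> n" "2 * n * d \<le> T"
  shows "ereal (5 / 8 * real (d * n) - real T / 8) \<le> minimax_flow_regret T (block_class n d)"
  unfolding minimax_flow_regret_def
proof (rule INF_greatest)
  fix M :: "(nat list \<Rightarrow> nat) measure" assume M: "M \<in> randomized_learners"
  define good where "good t \<longleftrightarrow> even t \<and> t \<le> 2 * n * d" for t
  \<comment> \<open>Bits are shown at even times after the start, where the adversary offers both
    values; at the remaining positive times any eight states will do.\<close>
  define Y where "Y t = (if t = 0 then {prod_encode (0, 0)}
    else if good t then {prod_encode (t, 0), prod_encode (t, 1)} else {..<8})" for t
  have card_Y: "card (Y t) = (if t = 0 then 1 else if good t then 2 else 8)" for t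
    by (simp add: Y_def)
  have "\<exists>y. y \<in> Y (length xs) \<and> predict_prob M xs y \<le> 1 / card (Y (length xs))" for xs
    using exists_unlikely_prediction [OF M, of "Y (length xs)" xs]
    by (auto simp: Y_def lessThan_empty_iff simp del: lessThan_def)
  from history_choice [of "\<lambda>xs y. y \<in> Y (length xs) \<and> predict_prob M xs y \<le> 1 / card (Y (length xs))", OF this]
  obtain x where x: "x t \<in> Y t" "predict_prob M (map x [0..<t]) (x t) \<le> 1 / card (Y t)" for t
    by auto
  \<comment> \<open>Bit \<open>i\<close> of block \<open>j\<close> is read in the second of two
    steps, hence shown at time \<open>2 * (j * n + i) + 2\<close>.\<close>
  have "\<exists>v :: nat. v < 2 ^ n \<and>
      (\<forall>i<n. bit v i \<longleftrightarrow> x (2 * (j * n + i) + 2) = prod_encode (2 * (j * n + i) + 2, 1))" for j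
    by (rule exists_nat_with_bits)
  then obtain w\<^sub>0 :: "nat \<Rightarrow> nat" where w\<^sub>0: "\<And>j. w\<^sub>0 j < 2 ^ n"
    "\<And>j i. i < n \<Longrightarrow> bit (w\<^sub>0 j) i \<longleftrightarrow> x (2 * (j * n + i) + 2) = prod_encode (2 * (j * n + i) + 2, 1)"
    by metis
  define w where "w j = (if j < d then w\<^sub>0 j else 0)" for j
  define f where "f = block_map n w"
  have f: "f \<in> block_class n d"
    using w\<^sub>0(1) by (auto simp: block_class_def f_def w_def)
  have x0: "x 0 = prod_encode (0, 0)" using x(1) [of 0] by (simp add: Y_def)
  have follows: "(f ^^ t) (x 0) = x t" if t: "good t" "t \<ge> 1" for t
  proof -
    obtain m where m: "t = 2 * m" using t(1) by (auto simp: good_def elim: evenE)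
    then obtain r where "m = Suc r" using t(2) by (cases m) auto
    then have r: "t = 2 * r + 2" using m by simp
    have "r < n * d" using t(1) by (simp add: good_def r)
    then have "r div n < d" by (simp add: less_mult_imp_div_less mult.commute)
    \<comment> \<open>At odd times the orbit of \<open>f\<close> carries its code while
      \<open>x\<close> may be elsewhere; only the orbit enters the next bit.\<close>
    have "(f ^^ Suc (2 * r)) (x 0) = prod_encode (Suc (2 * r), w (r div n))"
      unfolding f_def x0 by (rule block_map_funpow_Suc [where n = n and w = w and t = "2 * r"]) simp
    then have "(f ^^ Suc (Suc (2 * r))) (x 0) = prod_encode (t, of_bool (bit (w (r div n)) (r mod n)))"
      by (simp add: f_def block_map_encode r)
    also have "bit (w (r div n)) (r mod n) \<longleftrightarrow> x t = prod_encode (t, 1)"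
      using \<open>r div n < d\<close> w\<^sub>0(2) [of "r mod n" "r div n"] assms(1) by (simp add: w_def r)
    also have "prod_encode (t, of_bool (x t = prod_encode (t, 1))) = x t"
      using x(1) [of t] t by (auto simp: Y_def)
    finally show ?thesis by (simp add: r)
  qed
  \<comment> \<open>At bit times the gain is at least \<open>1/2 = 5/8 - 1/8\<close>; at other times
    it is at least \<open>7/8 - 1 = - 1/8\<close>.\<close>
  have step: "5 / 8 * of_bool (good t) - 1 / 8
      \<le> (1 - predict_prob M (map x [0..<t]) (x t)) - of_bool ((f ^^ t) (x 0) \<noteq> x t)"
    if "t \<in> {1..T}" for t
    using x(2) [of t] follows [of t] that by (cases "good t") (auto simp: card_Y)
  have "n * d \<le> card ({1..T} \<inter> {t. good t})"
  proof -
    have "(\<lambda>r. 2 * r + 2) ` {..<n * d} \<subseteq> {1..T} \<inter> {t. good t}"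
      using assms(2) by (auto simp: good_def)
    then have "card ((\<lambda>r. 2 * r + 2) ` {..<n * d}) \<le> card ({1..T} \<inter> {t. good t})"
      by (rule card_mono [rotated]) simp
    then show ?thesis by (subst (asm) card_image) (auto simp: inj_on_def)
  qed
  then have "5 / 8 * real (d * n) - real T / 8 \<le> 5 / 8 * real (card ({1..T} \<inter> {t. good t})) - T / 8"
    by (simp add: mult.commute flip: of_nat_mult)
  also have "\<dots> = (\<Sum>t = 1..T. 5 / 8 * of_bool (good t) - 1 / 8)"
    unfolding sum_subtractf sum_distrib_left [symmetric] by simp
  also have "\<dots> \<le> (\<Sum>t = 1..T. (1 - predict_prob M (map x [0..<t]) (x t))
      - of_bool ((f ^^ t) (x 0) \<noteq> x t))"
    by (rule sum_mono) (rule step)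
  also have "\<dots> = (\<Sum>t = 1..T. 1 - predict_prob M (map x [0..<t]) (x t))
      - (\<Sum>t = 1..T. of_bool ((f ^^ t) (x 0) \<noteq> x t))"
    by (rule sum_subtractf)
  finally show "ereal (5 / 8 * real (d * n) - real T / 8) \<le> flow_regret M T (block_class n d)"
    using flow_regret_ge [OF M f, where T = T and x = x] by (meson ereal_less_eq(3) order_trans)
qed

text \<open>For \<open>T < 4 * d\<close> the coin class has regret \<open>d / 2\<close> against a
  bound of at most \<open>7 * d\<close>. Otherwise the block class has regret at least
  \<open>5/24 T - 1/8 T = T / 12\<close> against a bound of at most \<open>3 * T\<close>, and this
  ratio is the 1/36.\<close>

lemma exists_class_regret_ge_bound:
  assumes "1 \<le> d" "d \<le> T"
  shows "\<exists>F :: (nat \<Rightarrow> nat) set. F \<noteq> {} \<and> evolution_complexity T F = d \<and>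
    ereal (1 / 36) * flow_regret_bound d T (max_images F) \<le> minimax_flow_regret T F"
proof (cases "T < 4 * d")
  case True
  have "ln (real T * 2 / d) \<le> real T * 2 / d"
    using ln_bound [of "real T * 2 / d"] assms by simp
  \<comment> \<open>The quotient is below 8; the constant 9 makes \<open>4 * 9\<close> a
    square.\<close>
  also have "\<dots> \<le> 9" using True assms by (simp add: field_simps)
  finally have "real d * T * ln (real T * 2 / d) \<le> real d * (4 * d) * 9"
    using True assms by (intro mult_mono) auto
  also have "\<dots> = (6 * real d)\<^sup>2" by (simp add: power2_eq_square)
  finally have "sqrt (real d * T * ln (real T * 2 / d)) \<le> 6 * real d"
    by (intro real_le_lsqrt) auto
  moreover have "flow_regret_bound d T (max_images (coin_class d))
      \<le> ereal (d + sqrt (real d * T * ln (real T * 2 / d)))"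
    using flow_regret_bound_le [OF assms _ max_images_coin_class [of d]] by simp
  ultimately have "flow_regret_bound d T (max_images (coin_class d)) \<le> ereal (7 * d)"
    by (elim order_trans) simp
  then have "ereal (1 / 36) * flow_regret_bound d T (max_images (coin_class d)) \<le> ereal (1 / 36) * ereal (7 * d)"
    by (rule ereal_mult_left_mono) simp
  also have "\<dots> \<le> minimax_flow_regret T (coin_class d)"
    using minimax_flow_regret_coin_class [OF assms(2)] by simp
  finally show ?thesis
    using evolution_complexity_coin_class [OF assms(2)]
    by (intro exI [of _ "coin_class d"]) (simp add: coin_class_def)
next
  case False
  define n where "n = T div (2 * d)"
  have "2 * (2 * d) \<le> T" using False by simp
  then have "2 \<le> n" using assms(1) by (simp add: n_def less_eq_div_iff_mult_less_eq)
  have le: "2 * n * d \<le> T" unfolding n_def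
    by (metis mult.assoc mult.commute div_times_less_eq_dividend)
  have "T < 2 * d * (n + 1)"
    unfolding n_def using assms(1) dividend_less_div_times [of "2 * d" T] by (simp add: algebra_simps)
  moreover have "2 * d \<le> n * d" using \<open>2 \<le> n\<close> by (rule mult_le_mono1)
  moreover have "2 * d * (n + 1) = 2 * (d * n) + 2 * d" "n * d = d * n" by simp_all
  \<comment> \<open>Rounding in \<open>n\<close> loses less than \<open>2 * d\<close>, which is at
    most \<open>n * d\<close> because \<open>n \<ge> 2\<close>.\<close>
  ultimately have "T \<le> 3 * (d * n)" by linarith
  then have T: "real T \<le> 3 * (real d * n)" by (metis of_nat_le_iff of_nat_mult of_nat_numeral)
  let ?F = "block_class n d"
  have C: "evolution_complexity T ?F = d"
    using evolution_complexity_block_class_le [of T n d] evolution_complexity_block_class_ge [of n d T]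
      \<open>2 \<le> n\<close> le by simp
  have "ln (real T * 2 ^ n / d) = ln (real T / d) + n * ln 2"
    using assms by (simp add: ln_mult ln_div ln_realpow)
  also have "\<dots> \<le> real T / d + real n * 1"
    using assms ln_bound [of "real T / d"] ln_bound [of "2 :: real"] ln_2_less_1
    by (intro add_mono mult_left_mono) auto
  also have "real n * 1 \<le> real T / d"
    using of_nat_mono [OF le, where 'a = real] assms by (simp add: field_simps)
  finally have "real d * T * ln (real T * 2 ^ n / d) \<le> real d * T * (real T / d + real T / d)"
    by (intro mult_left_mono) auto
  also have "\<dots> = 2 * (real T)\<^sup>2" using assms by (simp add: power2_eq_square field_simps)
  also have "\<dots> \<le> (2 * real T)\<^sup>2" by (simp add: power_mult_distrib)
  finally have "sqrt (real d * T * ln (real T * 2 ^ n / d)) \<le> 2 * real T"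
    by (intro real_le_lsqrt) auto
  moreover have "flow_regret_bound d T (max_images ?F)
      \<le> ereal (d + sqrt (real d * T * ln (real T * 2 ^ n / d)))"
    using flow_regret_bound_le [OF assms _ max_images_block_class [of n d]] \<open>2 \<le> n\<close> by simp
  ultimately have "flow_regret_bound d T (max_images ?F) \<le> ereal (3 * T)"
    using assms(2) by (elim order_trans) simp
  then have "ereal (1 / 36) * flow_regret_bound d T (max_images ?F) \<le> ereal (1 / 36) * ereal (3 * T)"
    by (rule ereal_mult_left_mono) simp
  also have "\<dots> \<le> ereal (5 / 8 * real (d * n) - real T / 8)"
    using T by simp
  also have "\<dots> \<le> minimax_flow_regret T ?F"
    using minimax_flow_regret_block_class_ge [of n d T] \<open>2 \<le> n\<close> le by simp
  finally show ?thesis using C block_class_nonempty by blast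
qed

theorem theorem17:
  shows "(\<forall>(F :: ('x::order \<Rightarrow> 'x) set) (T :: nat). F \<noteq> {} \<longrightarrow>
            ereal (real (evolution_complexity T F) / 2) \<le> minimax_flow_regret T F \<and>
            minimax_flow_regret T F
              \<le> flow_regret_bound (evolution_complexity T F) T (max_images F))
       \<and> (\<forall>(T :: nat) (d :: nat). 1 \<le> d \<and> d \<le> T \<longrightarrow>
            (\<exists>F :: (nat \<Rightarrow> nat) set. F \<noteq> {} \<and> evolution_complexity T F = d \<and>
               minimax_flow_regret T F = ereal (real (evolution_complexity T F) / 2)))
       \<and> (\<exists>c :: real. c > 0 \<and>
            (\<forall>(T :: nat) (d :: nat). 1 \<le> d \<and> d \<le> T \<longrightarrow>
               (\<exists>F :: (nat \<Rightarrow> nat) set. F \<noteq> {} \<and> evolution_complexity T F = d \<and>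
                  minimax_flow_regret T F
                    \<ge> ereal c * flow_regret_bound (evolution_complexity T F) T (max_images F))))"
proof (intro conjI allI impI)
  fix F :: "('x \<Rightarrow> 'x) set" and T assume "F \<noteq> {}"
  then show "ereal (real (evolution_complexity T F) / 2) \<le> minimax_flow_regret T F"
    by (rule half_evolution_complexity_le_minimax_flow_regret)
  show "minimax_flow_regret T F \<le> flow_regret_bound (evolution_complexity T F) T (max_images F)"
    using \<open>F \<noteq> {}\<close> by (rule minimax_flow_regret_le_flow_regret_bound)
next
  fix T d :: nat assume "1 \<le> d \<and> d \<le> T"
  then show "\<exists>F :: (nat \<Rightarrow> nat) set. F \<noteq> {} \<and> evolution_complexity T F = d \<and>
      minimax_flow_regret T F = ereal (real (evolution_complexity T F) / 2)"
    using evolution_complexity_coin_class minimax_flow_regret_coin_class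
    by (intro exI [of _ "coin_class d"]) (simp add: coin_class_def)
next
  show "\<exists>c :: real. c > 0 \<and>
      (\<forall>(T :: nat) (d :: nat). 1 \<le> d \<and> d \<le> T \<longrightarrow>
        (\<exists>F :: (nat \<Rightarrow> nat) set. F \<noteq> {} \<and> evolution_complexity T F = d \<and>
          minimax_flow_regret T F
            \<ge> ereal c * flow_regret_bound (evolution_complexity T F) T (max_images F)))"
    using exists_class_regret_ge_bound by (intro exI [of _ "1 / 36"]) fastforce
qed

end
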